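(* Let $n\ge t\geq 15$ be integers and let $p$ be a real number with $0<p\leq p_0(t)$, where $p_0(t)=\frac{2}{\sqrt{4t+9}-1}$. Let $\mathcal{G}\subset 2^{[n]}$ be a $3$-wise $t$-intersecting family. Then $\mu_p(\mathcal{G})\leq p^t$. Moreover, equality $\mu_p(\mathcal G)=p^t$ holds if and only if $\mathcal{G}\cong\mathcal{F}_0^t$, or $p=p_0(t)$ and $\mathcal{G}\cong\mathcal{F}_1^t$.
   Context: $[n]=\{1,2,\ldots,n\}$ and $2^{[n]}$ is its power set. A family $\mathcal{G}\subset 2^{[n]}$ is $3$-wise $t$-intersecting if $|G_1\cap G_2\cap G_3|\geq t$ for all $G_1,G_2,G_3\in\mathcal{G}$ (not necessarily distinct). For $0<p<1$ and $q=1-p$, the $p$-biased measure is $\mu_p(\mathcal{G})=\sum_{G\in\mathcal{G}}p^{|G|}q^{n-|G|}$. For integers $0\le s\le\lfloor\frac{n-t}{3}\rfloor$, $\mathcal{F}_s^t=\mathcal{F}_s^t(n)=\{F\in 2^{[n]}: |F\cap[t+3s]|\geq t+2s\}$; thus $\mathcal{F}_1^t$ is defined only when $n\ge t+3$, and alternatives involving $\mathcal{F}_1^t$ do not occur otherwise. Two families $\mathcal{F},\mathcal{F}'\subset 2^{[n]}$ are isomorphic, written $\mathcal{F}\cong\mathcal{F}'$, if there is a permutation $\pi$ of $[n]$ with $\mathcal{F}'=\{\{\pi(x):x\in F\}:F\in\mathcal{F}\}$. *)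

theory Defs
  imports Complex_Main "HOL-Combinatorics.Permutations"
begin

definition three_wise_intersecting :: "nat \<Rightarrow> nat set set \<Rightarrow> bool" where
  "three_wise_intersecting t \<G> \<longleftrightarrow>
     (\<forall>G1\<in>\<G>. \<forall>G2\<in>\<G>. \<forall>G3\<in>\<G>. t \<le> card (G1 \<inter> G2 \<inter> G3))"

definition biased_measure :: "nat \<Rightarrow> real \<Rightarrow> nat set set \<Rightarrow> real" where
  "biased_measure n p \<G> = (\<Sum>G\<in>\<G>. p ^ card G * (1 - p) ^ (n - card G))"

text \<open>
  The family \<open>\<F>\<^sub>s\<^sup>t(n)\<close> is only meaningful for \<open>t + 3 * s \<le> n\<close>; this side condition is
  not part of the definition and has to be imposed where the family is used.
\<close>

definition frankl_family :: "nat \<Rightarrow> nat \<Rightarrow> nat \<Rightarrow> nat set set" where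
  "frankl_family n t s = {F. F \<subseteq> {1..n} \<and> t + 2 * s \<le> card (F \<inter> {1..t + 3 * s})}"

definition isomorphic_families :: "nat \<Rightarrow> nat set set \<Rightarrow> nat set set \<Rightarrow> bool" where
  "isomorphic_families n \<F> \<F>' \<longleftrightarrow> (\<exists>\<pi>. \<pi> permutes {1..n} \<and> \<F>' = (\<lambda>F. \<pi> ` F) ` \<F>)"

definition p0 :: "nat \<Rightarrow> real" where
  "p0 t = 2 / (sqrt (4 * real t + 9) - 1)"

end

theory Submission
  imports Defs "HOL-Computational_Algebra.Polynomial" "HOL-Analysis.Complex_Transcendental"
begin

text \<open>
The bound \<open>p \<le> p0 t\<close> says exactly that the second Frankl family \<open>\<F>\<^sub>1\<close> has measure at most \<open>p ^ t\<close>, the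
measure of the first one, \<open>\<F>\<^sub>0\<close>. What has to be shown is that every family contained in no copy of either of
them is strictly smaller.

Shifting (replacing an element by a smaller one wherever this gives a new set) preserves the measure and the
intersection property, and by \<open>shift_eq_near\<close> only copies of the Frankl families are shifted to copies of
the Frankl families. So the family \<open>G\<close> may be taken shifted, and up-closed as well.

Write \<open>q = 1 - p\<close> and sort the members of \<open>G\<close> by the set of their holes, the missing elements, in \<open>{1..t}\<close>.
In a shifted three-wise \<open>d\<close>-intersecting family with \<open>d \<ge> 1\<close> the sets containing the first element form a \<open>(d - 1)\<close>-intersecting
family on the remaining elements, and those missing it form a \<open>(d + 2)\<close>-intersecting one. Hence the tails above
\<open>t\<close> of the members with given \<open>i\<close> holes form a three-wise \<open>3 i\<close>-intersecting family, and the measure of a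
shifted three-wise \<open>d\<close>-intersecting family is at most \<open>\<alpha> ^ d\<close> whenever \<open>p + q \<alpha>\<^sup>3 \<le> \<alpha>\<close> (\<open>mu_shifted_le\<close>).
Here \<open>\<alpha>\<close> can be taken only slightly larger than \<open>p\<close>, and since \<open>t p\<^sup>2\<close> is at most about 1, the members
with \<open>i\<close> holes contribute at most about \<open>p ^ t / i!\<close>. The sum, about \<open>e\<close> times \<open>p ^ t\<close>, is too large by a
constant factor only.

If \<open>G\<close> is contained in neither Frankl family, the terms \<open>i = 0\<close> and \<open>i = 1\<close> become much smaller. A member
of \<open>G\<close> with \<open>m\<close> holes yields the complement of an interval of \<open>m\<close> elements, which forces the tails of any two members
containing \<open>{1..t}\<close> to have \<open>m\<close> common elements; in a similar way it acts on the members with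
one hole. A pairwise \<open>d\<close>-intersecting family has measure at most \<open>p ^ d\<close> for \<open>d = 1\<close> and \<open>p \<le> 1/2\<close>, and
for \<open>d = 2\<close> and \<open>p \<le> 1/3\<close> (\<open>mu_intersecting\<close>, \<open>mu_2_intersecting\<close>, by a spectral argument). So these terms lose
factors \<open>p\<close> or \<open>p\<^sup>2\<close>. If no member has three holes in \<open>{1..t}\<close>, the terms \<open>i \<ge> 3\<close> are
absent; otherwise the factors are \<open>p\<^sup>2\<close>. In either case the sum is below \<open>p ^ t\<close> for \<open>t \<ge> 15\<close>
(\<open>mu_shifted_less\<close>).
\<close>

section \<open>Biased measure on a finite ground set\<close>

text \<open>The ground set varies, because the proof passes to links of the family on subsets of \<open>{1..n}\<close>.\<close>

definition mu :: "real \<Rightarrow> 'a set \<Rightarrow> 'a set set \<Rightarrow> real" where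
  "mu p V H = (\<Sum>F\<in>H. p ^ card F * (1 - p) ^ (card V - card F))"

lemma mu_mono:
  assumes "finite V" "H' \<subseteq> Pow V" "H \<subseteq> H'" "0 \<le> p" "p \<le> 1"
  shows "mu p V H \<le> mu p V H'"
  unfolding mu_def using assms
  by (intro sum_mono2) (auto intro: finite_subset[of _ "Pow V"])

lemma mu_nonneg: "0 \<le> p \<Longrightarrow> p \<le> 1 \<Longrightarrow> 0 \<le> mu p V H"
  unfolding mu_def by (intro sum_nonneg) auto

lemma mu_strict_mono:
  assumes "finite V" "H' \<subseteq> Pow V" "H \<subset> H'" "0 < p" "p < 1"
  shows "mu p V H < mu p V H'"
proof -
  have fin: "finite H'" using assms by (auto intro: finite_subset[of _ "Pow V"])
  obtain F where F: "F \<in> H'" "F \<notin> H" using assms by auto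
  have "mu p V H < mu p V (insert F H)"
    unfolding mu_def using F fin assms by (subst sum.insert) (auto intro: finite_subset)
  also have "\<dots> \<le> mu p V H'" using assms F by (intro mu_mono) auto
  finally show ?thesis .
qed

lemma mu_split:
  assumes "finite A" "finite B" "A \<inter> B = {}" "H \<subseteq> Pow (A \<union> B)"
  shows "mu p (A \<union> B) H =
    (\<Sum>S\<in>Pow A. p ^ card S * (1 - p) ^ (card A - card S) * mu p B {X\<in>Pow B. S \<union> X \<in> H})"
proof -
  have "mu p (A \<union> B) H = (\<Sum>(S, X)\<in>(SIGMA S:Pow A. {X\<in>Pow B. S \<union> X \<in> H}).
      p ^ card S * (1 - p) ^ (card A - card S) * (p ^ card X * (1 - p) ^ (card B - card X)))"
    unfolding mu_def
  proof (rule sum.reindex_bij_witness[where i = "\<lambda>(S, X). S \<union> X" and j = "\<lambda>F. (F \<inter> A, F \<inter> B)"], goal_cases)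
    case (5 F)
    then have F: "F \<subseteq> A \<union> B" using assms by auto
    have 1: "card F = card (F \<inter> A) + card (F \<inter> B)"
      using F assms by (subst card_Un_disjoint[symmetric]) (auto intro: arg_cong[where f = card])
    have 2: "card (A \<union> B) = card A + card B" using assms by (simp add: card_Un_disjoint)
    have 3: "card (F \<inter> A) \<le> card A" "card (F \<inter> B) \<le> card B"
      using assms by (auto intro: card_mono)
    have "card (A \<union> B) - card F = (card A - card (F \<inter> A)) + (card B - card (F \<inter> B))"
      using 1 2 3 by linarith
    then show ?case using 1 by (simp add: power_add)
  next
    case (2 F)
    then have "F \<inter> A \<union> F \<inter> B = F" using assms(4) by auto
    with 2 show ?case by auto
  qed (use assms in auto)
  also have "\<dots> = (\<Sum>S\<in>Pow A. p ^ card S * (1 - p) ^ (card A - card S) * mu p B {X\<in>Pow B. S \<union> X \<in> H})"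
    unfolding mu_def sum_distrib_left using assms
    by (subst sum.Sigma) auto
  finally show ?thesis .
qed

lemma mu_insert:
  assumes "finite V" "x \<notin> V" "H \<subseteq> Pow (insert x V)"
  shows "mu p (insert x V) H =
    p * mu p V {X\<in>Pow V. insert x X \<in> H} + (1 - p) * mu p V {X\<in>Pow V. X \<in> H}"
  using mu_split[of "{x}" V H p] assms by (simp add: Pow_insert)

lemma mu_Pow: "finite V \<Longrightarrow> mu p V (Pow V) = 1"
proof (induction V rule: finite_induct)
  case empty
  then show ?case by (simp add: mu_def)
next
  case (insert x V)
  have "{X\<in>Pow V. insert x X \<in> Pow (insert x V)} = Pow V" "{X\<in>Pow V. X \<in> Pow (insert x V)} = Pow V"
    by auto
  then show ?case using insert by (simp add: mu_insert)
qed

lemma mu_le_1: "finite V \<Longrightarrow> H \<subseteq> Pow V \<Longrightarrow> 0 \<le> p \<Longrightarrow> p \<le> 1 \<Longrightarrow> mu p V H \<le> 1"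
  using mu_mono[of V "Pow V" H p] mu_Pow[of V p] by simp


section \<open>Pairwise intersecting families\<close>

text \<open>\<open>noise_kernel p V F G\<close> is the probability, as a polynomial in the correlation \<open>\<lambda>\<close>, that a pair of
\<open>\<lambda>\<close>-correlated random subsets of \<open>V\<close>, each distributed according to the \<open>p\<close>-biased measure, takes
the value \<open>(F, G)\<close>: the three factors are the coordinates that lie in both, in exactly one and in
none of the two sets.\<close>

definition noise_kernel :: "real \<Rightarrow> 'a set \<Rightarrow> 'a set \<Rightarrow> 'a set \<Rightarrow> real poly" where
  "noise_kernel p V F G = [:p\<^sup>2, p * (1 - p):] ^ card (F \<inter> G)
     * [:p * (1 - p), - (p * (1 - p)):] ^ card (F - G \<union> (G - F))
     * [:(1 - p)\<^sup>2, p * (1 - p):] ^ card (V - (F \<union> G))"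

text \<open>For the indicator of a family this is its noise stability. The coefficient of \<open>\<lambda>\<^sup>k\<close> is the total
squared Fourier weight of \<open>f\<close> on level \<open>k\<close>; only its sign and the level-zero weight are needed, so
no Fourier basis is set up.\<close>

definition noise_poly :: "real \<Rightarrow> 'a set \<Rightarrow> ('a set \<Rightarrow> real) \<Rightarrow> real poly" where
  "noise_poly p V f = (\<Sum>F\<in>Pow V. \<Sum>G\<in>Pow V. smult (f F * f G) (noise_kernel p V F G))"

lemma sum_Pow_insert:
  assumes "finite V" "x \<notin> V"
  shows "(\<Sum>F\<in>Pow (insert x V). f F) = (\<Sum>F\<in>Pow V. f F + f (insert x F))"
proof -
  have "inj_on (insert x) (Pow V)" using assms(2)
    by (intro inj_onI) (metis PowD insert_ident subsetD)
  moreover have "Pow V \<inter> insert x ` Pow V = {}" using assms by auto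
  ultimately show ?thesis using assms
    by (simp add: Pow_insert sum.union_disjoint sum.reindex sum.distrib)
qed

lemma noise_kernel_insert:
  assumes "finite V" "x \<notin> V" "F \<subseteq> V" "G \<subseteq> V"
  shows "noise_kernel p (insert x V) F G = [:(1 - p)\<^sup>2, p * (1 - p):] * noise_kernel p V F G"
    and "noise_kernel p (insert x V) (insert x F) G = [:p * (1 - p), - (p * (1 - p)):] * noise_kernel p V F G"
    and "noise_kernel p (insert x V) F (insert x G) = [:p * (1 - p), - (p * (1 - p)):] * noise_kernel p V F G"
    and "noise_kernel p (insert x V) (insert x F) (insert x G) = [:p\<^sup>2, p * (1 - p):] * noise_kernel p V F G"
proof -
  have fin: "finite F" "finite G" using assms by (auto intro: finite_subset)
  have x: "x \<notin> F" "x \<notin> G" using assms by auto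
  have 1: "insert x V - (F \<union> G) = insert x (V - (F \<union> G))" using x by auto
  have 2: "insert x V - (insert x F \<union> G) = V - (F \<union> G)" 
    "insert x V - (F \<union> insert x G) = V - (F \<union> G)"
    "insert x V - (insert x F \<union> insert x G) = V - (F \<union> G)"using assms x by auto
  have 3: "insert x F \<inter> G = F \<inter> G" "F \<inter> insert x G = F \<inter> G"
    "insert x F \<inter> insert x G = insert x (F \<inter> G)" using x by auto
  have 4: "(insert x F - G) \<union> (G - insert x F) = insert x (F - G \<union> (G - F))"
    "(F - insert x G) \<union> (insert x G - F) = insert x (F - G \<union> (G - F))"
    "(insert x F - insert x G) \<union> (insert x G - insert x F) = F - G \<union> (G - F)" using x by auto
  show "noise_kernel p (insert x V) F G = [:(1 - p)\<^sup>2, p * (1 - p):] * noise_kernel p V F G"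
    unfolding noise_kernel_def 1 using assms x by (simp add: fin ac_simps del: mult_pCons_left mult_pCons_right)
  show "noise_kernel p (insert x V) (insert x F) G = [:p * (1 - p), - (p * (1 - p)):] * noise_kernel p V F G"
    unfolding noise_kernel_def 2 3 4 using assms x fin by (simp add: ac_simps del: mult_pCons_left mult_pCons_right)
  show "noise_kernel p (insert x V) F (insert x G) = [:p * (1 - p), - (p * (1 - p)):] * noise_kernel p V F G"
    unfolding noise_kernel_def 2 3 4 using assms x fin by (simp add: ac_simps del: mult_pCons_left mult_pCons_right)
  show "noise_kernel p (insert x V) (insert x F) (insert x G) = [:p\<^sup>2, p * (1 - p):] * noise_kernel p V F G"
    unfolding noise_kernel_def 2 3 4 using assms x fin by (simp add: ac_simps del: mult_pCons_left mult_pCons_right)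
qed

text \<open>Splitting off one coordinate: the average of the two restrictions keeps the level, their
difference raises it by one. This is where the coefficients get their sign.\<close>

lemma noise_poly_insert:
  assumes "finite V" "x \<notin> V"
  shows "noise_poly p (insert x V) f =
    noise_poly p V (\<lambda>F. (1 - p) * f F + p * f (insert x F))
    + smult (p * (1 - p)) (pCons 0 (noise_poly p V (\<lambda>F. f F - f (insert x F))))"
proof -
  have *: "smult (a * b) ([:(1 - p)\<^sup>2, p * (1 - p):] * K)
      + smult (a * b') ([:p * (1 - p), - (p * (1 - p)):] * K)
      + (smult (a' * b) ([:p * (1 - p), - (p * (1 - p)):] * K)
      + smult (a' * b') ([:p\<^sup>2, p * (1 - p):] * K))
    = smult (((1 - p) * a + p * a') * ((1 - p) * b + p * b')) K
      + smult (p * (1 - p)) (pCons 0 (smult ((a - a') * (b - b')) K))" for a b a' b' :: real and K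
    by (rule poly_ext) (simp add: algebra_simps power2_eq_square)
  have pc: "smult a (pCons 0 X) = [:0, a:] * X" for a :: real and X by simp
  have "noise_poly p (insert x V) f = (\<Sum>F\<in>Pow V. \<Sum>G\<in>Pow V.
      smult (f F * f G) (noise_kernel p (insert x V) F G)
      + smult (f F * f (insert x G)) (noise_kernel p (insert x V) F (insert x G))
      + (smult (f (insert x F) * f G) (noise_kernel p (insert x V) (insert x F) G)
      + smult (f (insert x F) * f (insert x G)) (noise_kernel p (insert x V) (insert x F) (insert x G))))"
    unfolding noise_poly_def using assms by (simp add: sum_Pow_insert sum.distrib)
  also have "\<dots> = (\<Sum>F\<in>Pow V. \<Sum>G\<in>Pow V.
      smult (((1 - p) * f F + p * f (insert x F)) * ((1 - p) * f G + p * f (insert x G))) (noise_kernel p V F G)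
      + smult (p * (1 - p)) (pCons 0 (smult ((f F - f (insert x F)) * (f G - f (insert x G))) (noise_kernel p V F G))))"
    using assms by (intro sum.cong refl) (simp only: noise_kernel_insert[OF assms] Pow_iff *)
  also have "\<dots> = noise_poly p V (\<lambda>F. (1 - p) * f F + p * f (insert x F))
    + [:0, p * (1 - p):] * (noise_poly p V (\<lambda>F. f F - f (insert x F)))"
    by (simp only: noise_poly_def pc sum.distrib sum_distrib_left)
  finally show ?thesis by simp
qed

lemma noise_poly_coeffs:
  assumes "finite V" "0 \<le> p" "p \<le> 1"
  shows "0 \<le> coeff (noise_poly p V f) k
    \<and> coeff (noise_poly p V f) 0 = (\<Sum>F\<in>Pow V. p ^ card F * (1 - p) ^ (card V - card F) * f F)\<^sup>2"
  using assms(1)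
proof (induction V arbitrary: f k rule: finite_induct)
  case empty
  show ?case by (auto simp: noise_poly_def noise_kernel_def power2_eq_square coeff_pCons split: nat.splits)
next
  case (insert x V)
  let ?g = "\<lambda>F. (1 - p) * f F + p * f (insert x F)"
  have "(\<Sum>F\<in>Pow (insert x V). p ^ card F * (1 - p) ^ (card (insert x V) - card F) * f F)
    = (\<Sum>F\<in>Pow V. p ^ card F * (1 - p) ^ (card V - card F) * ?g F)"
    unfolding sum_Pow_insert[OF insert.hyps(1,2)]
  proof (intro sum.cong refl)
    fix F assume "F \<in> Pow V"
    then have "finite F" "x \<notin> F" "card F \<le> card V" using insert.hyps
      by (auto intro: finite_subset card_mono)
    then show "p ^ card F * (1 - p) ^ (card (insert x V) - card F) * f F +
         p ^ card (insert x F) * (1 - p) ^ (card (insert x V) - card (insert x F)) * f (insert x F)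
         = p ^ card F * (1 - p) ^ (card V - card F) * ?g F"
      using insert.hyps by (simp add: Suc_diff_le algebra_simps)
  qed
  then show ?case
    unfolding noise_poly_insert[OF insert.hyps(1,2)]
    using insert.IH[of ?g] insert.IH[of "\<lambda>F. f F - f (insert x F)"] assms
    by (auto simp: coeff_pCons split: nat.splits)
qed

lemma noise_poly_indicator:
  assumes "finite V" "H \<subseteq> Pow V"
  shows "noise_poly p V (\<lambda>F. of_bool (F \<in> H)) = (\<Sum>F\<in>H. \<Sum>G\<in>H. noise_kernel p V F G)"
proof -
  have "noise_poly p V (\<lambda>F. of_bool (F \<in> H)) = 
     (\<Sum>F\<in>Pow V. \<Sum>G\<in>Pow V. if F \<in> H then if G \<in> H then noise_kernel p V F G else 0 else 0)"
    unfolding noise_poly_def by (intro sum.cong refl) auto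
  also have "\<dots> = (\<Sum>F\<in>Pow V. if F \<in> H then (\<Sum>G\<in>Pow V. if G \<in> H then noise_kernel p V F G else 0) else 0)"
    by (intro sum.cong refl) auto
  also have "\<dots> = (\<Sum>F\<in>H. \<Sum>G\<in>H. noise_kernel p V F G)"
    using assms by (simp add: sum.If_cases Int_absorb1 Int_absorb2 Collect_mem_eq flip: sum.inter_restrict)
  finally show ?thesis .
qed


lemma noise_poly_indicator_coeff_0:
  assumes "finite V" "H \<subseteq> Pow V" "0 \<le> p" "p \<le> 1"
  shows "coeff (noise_poly p V (\<lambda>F. of_bool (F \<in> H))) 0 = (mu p V H)\<^sup>2"
proof -
  have "(\<Sum>F\<in>Pow V. p ^ card F * (1 - p) ^ (card V - card F) * of_bool (F \<in> H))
    = (\<Sum>F\<in>Pow V. if F \<in> H then p ^ card F * (1 - p) ^ (card V - card F) else 0)"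
    by (intro sum.cong refl) auto
  also have "\<dots> = mu p V H"
    unfolding mu_def using assms by (simp add: Int_absorb1 flip: sum.inter_restrict)
  finally show ?thesis
    using noise_poly_coeffs[OF assms(1,3,4), of "\<lambda>F. of_bool (F \<in> H)" 0] by simp
qed

text \<open>At correlation 1 the two random sets coincide, so the total Fourier weight of a family is its
measure.\<close>

lemma noise_poly_indicator_at_1:
  assumes "finite V" "H \<subseteq> Pow V"
  shows "poly (noise_poly p V (\<lambda>F. of_bool (F \<in> H))) 1 = mu p V H"
proof -
  have fin: "finite H" using assms by (auto intro: finite_subset[of _ "Pow V"])
  have "poly (noise_kernel p V F G) 1 = (if G = F then p ^ card F * (1 - p) ^ (card V - card F) else 0)"
    if "F \<in> H" "G \<in> H" for F G
  proof -
    have FG: "F \<subseteq> V" "G \<subseteq> V" "finite F" "finite G" using that assms by (auto intro: finite_subset)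
    have "card (F - G \<union> (G - F)) = 0 \<longleftrightarrow> G = F" using FG by auto
    moreover have "p * p + p * (1 - p) = p" "(1 - p) * (1 - p) + p * (1 - p) = 1 - p"
      by (simp_all add: algebra_simps)
    ultimately show ?thesis
      using FG by (auto simp: noise_kernel_def power2_eq_square card_Diff_subset)
  qed
  then have "poly (noise_poly p V (\<lambda>F. of_bool (F \<in> H))) 1
    = (\<Sum>F\<in>H. \<Sum>G\<in>H. if G = F then p ^ card F * (1 - p) ^ (card V - card F) else 0)"
    unfolding noise_poly_indicator[OF assms] poly_sum by (intro sum.cong refl) simp
  also have "\<dots> = mu p V H" unfolding mu_def using fin by simp
  finally show ?thesis .
qed

text \<open>The ratio bound of Hoffman in terms of level weights: the weights sum to \<open>m\<close>, the weight on level
0 is \<open>m\<^sup>2\<close>, and a combination \<open>e\<close> of the levels that vanishes on the family but is at least \<open>- c\<close>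
away from level 0 cannot be balanced when \<open>m\<close> is large.\<close>

lemma hoffman_bound:
  fixes P :: "real poly" and e :: "nat \<Rightarrow> real"
  assumes "\<And>k. 0 \<le> coeff P k" "coeff P 0 = m\<^sup>2" "poly P 1 = m"
    and "(\<Sum>k\<le>degree P. coeff P k * e k) = 0" "e 0 = 1" "\<And>k. 0 < k \<Longrightarrow> - c \<le> e k" "0 \<le> c"
  shows "m * (1 + c) \<le> c"
proof -
  have m: "(\<Sum>k\<le>degree P. coeff P k) = m" using assms(3) by (simp add: poly_altdef)
  have "m\<^sup>2 * (1 + c) - c * m = (\<Sum>k\<le>degree P. (if k = 0 then m\<^sup>2 * (1 + c) else 0) - c * coeff P k)"
    by (simp add: sum_subtractf flip: sum_distrib_left m)
  also have "\<dots> \<le> (\<Sum>k\<le>degree P. coeff P k * e k)"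
  proof (intro sum_mono)
    fix k
    show "(if k = 0 then m\<^sup>2 * (1 + c) else 0) - c * coeff P k \<le> coeff P k * e k"
    proof (cases "k = 0")
      case False
      then have "coeff P k * (- c) \<le> coeff P k * e k" using assms by (intro mult_left_mono) auto
      with False show ?thesis by (simp add: mult.commute)
    qed (simp add: assms algebra_simps)
  qed
  finally have *: "m * (m * (1 + c)) \<le> m * c" using assms(4) by (simp add: power2_eq_square algebra_simps)
  have "0 \<le> m" unfolding m[symmetric] using assms(1) by (intro sum_nonneg) auto
  then show ?thesis using * assms(7) by (cases "m = 0") auto
qed

lemma sum_coeff_pderiv:
  fixes P :: "real poly"
  shows "(\<Sum>k\<le>degree P. coeff P k * (real k * l ^ (k - 1))) = poly (pderiv P) l"
proof -
  have "pderiv P = (\<Sum>k\<le>degree P. pderiv (monom (coeff P k) k))"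
    by (subst (1) poly_as_sum_of_monoms[symmetric]) (simp add: higher_pderiv_sum[of 1, simplified])
  then show ?thesis by (simp add: poly_sum pderiv_monom poly_monom ac_simps)
qed

text \<open>A coordinate common to both sets contributes the factor \<open>p\<^sup>2 + p (1 - p) \<lambda>\<close>, which vanishes at
\<open>\<lambda> = - p / (1 - p)\<close>. For a pairwise \<open>d\<close>-intersecting family the noise polynomial therefore has a
root of order \<open>d\<close> there, that is, \<open>d\<close> linear relations between the level weights.\<close>

lemma noise_poly_dvd:
  assumes "finite V" "H \<subseteq> Pow V" "\<And>F G. F \<in> H \<Longrightarrow> G \<in> H \<Longrightarrow> d \<le> card (F \<inter> G)"
  shows "[:p\<^sup>2, p * (1 - p):] ^ d dvd noise_poly p V (\<lambda>F. of_bool (F \<in> H))"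
  unfolding noise_poly_indicator[OF assms(1,2)] noise_kernel_def
  by (intro dvd_sum dvd_mult2 le_imp_power_dvd assms(3))

text \<open>Up to the factor \<open>- (1 + 2 * r)\<close> the left-hand side is the weight that the combination of the two
relations used below for 2-intersecting families gives to level \<open>k\<close>. Levels 1 and 2 attain the
bound; the hypothesis \<open>r \<le> 1/2\<close>, which is \<open>p \<le> 1/3\<close>, is what level 4 requires.\<close>

lemma even_level_bound:
  fixes r :: real
  assumes "0 < r" "r \<le> 1/2" "0 < k"
  shows "(- r) ^ k * ((real k - 1) + (real k - 2) * r) \<le> r\<^sup>2"
proof -
  have "k = 1 \<or> k = 2 \<or> k = 3 \<or> 4 \<le> k"
    using assms(3) by linarith
  then consider "k = 1" | "k = 2" | "odd k" "k \<ge> 3" | "even k" "4 \<le> k"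
    by (cases "even k") auto
  then show ?thesis
  proof cases
    case 3
    have "(- r) ^ k \<le> 0" using 3(1) assms(1) by simp
    moreover have "0 \<le> (real k - 2) * r" using 3(2) assms(1) by (intro mult_nonneg_nonneg) auto
    then have "0 \<le> (real k - 1) + (real k - 2) * r" using 3(2) by linarith
    ultimately have "(- r) ^ k * ((real k - 1) + (real k - 2) * r) \<le> 0" by (rule mult_nonpos_nonneg)
    also have "0 \<le> r\<^sup>2" by simp
    finally show ?thesis .
  next
    case 4
    define n where "n = k - 4"
    have k: "k = n + 4" using 4 n_def by simp
    have "real (n + 1) \<le> real (2 ^ n)"
      using less_exp[of n] by (simp only: of_nat_le_iff Suc_eq_plus1[symmetric] Suc_le_eq)
    then have 0: "real n + 1 \<le> 2 ^ n" by simp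
    have "(real n + 2) * r \<le> (real n + 2) * (1/2)" using assms(2) by (intro mult_left_mono) simp_all
    also have "\<dots> = real n / 2 + 1" by (simp add: field_simps)
    finally have 1: "real n + 3 + (real n + 2) * r \<le> 4 * 2 ^ n" using 0 by linarith
    have 2: "r ^ (n + 2) \<le> (1/2) ^ (n + 2)" using assms by (intro power_mono) auto
    have "r ^ (n + 2) * (real n + 3 + (real n + 2) * r) \<le> (1/2) ^ (n + 2) * (4 * 2 ^ n)"
      using assms by (intro mult_mono 1 2) auto
    also have "\<dots> = 1" by (simp add: power_add power_one_over)
    finally have "r\<^sup>2 * (r ^ (n + 2) * (real n + 3 + (real n + 2) * r)) \<le> r\<^sup>2 * 1"
      by (intro mult_left_mono) auto
    moreover have "(- r) ^ k = r\<^sup>2 * r ^ (n + 2)"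
    proof -
      have "(- r) ^ k = r ^ k" using 4(1) by simp
      also have "\<dots> = r ^ (2 + (n + 2))" using k by (intro arg_cong[of _ _ "power r"]) simp
      finally show ?thesis by (simp only: power_add[of r 2])
    qed
    moreover have "(real k - 1) + (real k - 2) * r = real n + 3 + (real n + 2) * r"
      using k by simp
    ultimately show ?thesis by (simp only: mult.assoc mult_1_right)
  qed (use assms in \<open>simp_all add: power2_eq_square\<close>)
qed
lemma mu_intersecting:
  assumes "finite V" "H \<subseteq> Pow V" "\<And>F G. F \<in> H \<Longrightarrow> G \<in> H \<Longrightarrow> 1 \<le> card (F \<inter> G)"
    and "0 < p" "p \<le> 1/2"
  shows "mu p V H \<le> p"
proof -
  have p: "0 \<le> p" "p \<le> 1" "p < 1" using assms(4,5) by auto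
  define r where "r = p / (1 - p)"
  have r: "0 < r" "r \<le> 1" "p\<^sup>2 - r * (p * (1 - p)) = 0"
    using assms(4,5) by (auto simp: r_def field_simps power2_eq_square)
  define P where "P = noise_poly p V (\<lambda>F. of_bool (F \<in> H))"
  have "[:p\<^sup>2, p * (1 - p):] ^ 1 dvd P" unfolding P_def using assms by (intro noise_poly_dvd)
  then obtain R where R: "P = [:p\<^sup>2, p * (1 - p):] * R" by auto
  have root: "poly P (- r) = 0" unfolding R poly_mult using r(3) by simp
  have "mu p V H * (1 + r) \<le> r"
  proof (rule hoffman_bound[where P = P and e = "\<lambda>k. (- r) ^ k"])
    fix k :: nat assume "0 < k"
    have "\<bar>(- r) ^ k\<bar> \<le> r" using r \<open>0 < k\<close> power_decreasing[of 1 k r] by (simp add: power_abs)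
    then show "- r \<le> (- r) ^ k" by linarith
  qed (use r root p in \<open>simp_all add: P_def noise_poly_coeffs(1)[THEN conjunct1] noise_poly_indicator_coeff_0
         noise_poly_indicator_at_1 assms(1,2) flip: poly_altdef\<close>)
  moreover have "1 + r = 1 / (1 - p)" using p by (simp add: r_def field_simps)
  ultimately have "mu p V H / (1 - p) \<le> p / (1 - p)" by (simp add: r_def)
  then show ?thesis using p by (simp add: divide_le_cancel)
qed

text \<open>The double root gives the relations \<open>P(-r) = 0\<close> and \<open>P'(-r) = 0\<close>. They are combined with the
factor \<open>b\<close> that makes the levels 1 and 2 equal; these are the levels on which the extremal
family, all sets containing two given points, lives, so the bound is sharp.\<close>

lemma mu_2_intersecting:
  assumes "finite V" "H \<subseteq> Pow V" "\<And>F G. F \<in> H \<Longrightarrow> G \<in> H \<Longrightarrow> 2 \<le> card (F \<inter> G)"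
    and "0 < p" "p \<le> 1/3"
  shows "mu p V H \<le> p\<^sup>2"
proof -
  have p: "0 \<le> p" "p \<le> 1" "p < 1" using assms(4,5) by auto
  define r where "r = p / (1 - p)"
  have r: "0 < r" "r \<le> 1/2" "p\<^sup>2 - r * (p * (1 - p)) = 0" "p = r / (1 + r)"
    using assms(4,5) by (auto simp: r_def field_simps power2_eq_square)
  define b where "b = r * (1 + r) / (1 + 2 * r)"
  define e where "e k = (- r) ^ k + b * (real k * (- r) ^ (k - 1))" for k
  define P where "P = noise_poly p V (\<lambda>F. of_bool (F \<in> H))"
  define A where "A = [:p\<^sup>2, p * (1 - p):]"
  have "A ^ 2 dvd P" unfolding P_def A_def using assms by (intro noise_poly_dvd)
  then obtain R where R: "P = A * (A * R)" by (metis dvdE mult.assoc power2_eq_square)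
  have A: "poly A (- r) = 0" using r(3) by (simp add: A_def)
  have root: "poly P (- r) = 0" "poly (pderiv P) (- r) = 0"
    unfolding R pderiv_mult poly_mult poly_add A by simp_all
  have "(\<Sum>k\<le>degree P. coeff P k * e k) = poly P (- r) + b * poly (pderiv P) (- r)"
    unfolding sum_coeff_pderiv[symmetric] poly_altdef[of P] sum_distrib_left sum.distrib[symmetric] e_def
    by (intro sum.cong refl) (simp add: algebra_simps)
  then have zero: "(\<Sum>k\<le>degree P. coeff P k * e k) = 0" using root by simp
  have e0: "e 0 = 1" by (simp add: e_def)
  have "mu p V H * (1 + r\<^sup>2 / (1 + 2 * r)) \<le> r\<^sup>2 / (1 + 2 * r)"
  proof (rule hoffman_bound[where P = P and e = e])
    fix k :: nat assume k: "0 < k"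
    define y where "y = (- r) ^ (k - 1)"
    have y: "(- r) ^ k = - r * y" using k unfolding y_def by (metis power_eq_if not_gr_zero)
    have b: "(1 + 2 * r) * b = r * (1 + r)" using r(1) by (simp add: b_def)
    have "(1 + 2 * r) * e k = (1 + 2 * r) * (- r * y) + ((1 + 2 * r) * b) * (real k * y)"
      unfolding e_def y y_def[symmetric] by (simp only: distrib_left mult.assoc)
    also have "\<dots> = - ((- r) ^ k * ((real k - 1) + (real k - 2) * r))"
      unfolding b y by (simp add: algebra_simps)
    finally have "- r\<^sup>2 \<le> e k * (1 + 2 * r)" using even_level_bound[OF r(1,2) k] by (simp add: mult.commute)
    then have "- r\<^sup>2 / (1 + 2 * r) \<le> e k" using r(1) by (subst pos_divide_le_eq) auto
    then show "- (r\<^sup>2 / (1 + 2 * r)) \<le> e k" by simp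
  qed (use r zero p e0 in \<open>simp_all add: P_def noise_poly_coeffs(1)[THEN conjunct1] noise_poly_indicator_coeff_0
         noise_poly_indicator_at_1 assms(1,2)\<close>)
  moreover have "1 + r\<^sup>2 / (1 + 2 * r) = (1 + r)\<^sup>2 / (1 + 2 * r)" 
    using r(1) by (simp add: field_simps power2_eq_square)
  ultimately have "mu p V H * (1 + r)\<^sup>2 \<le> r\<^sup>2" using r(1) by (simp add: divide_le_cancel)
  then have "mu p V H \<le> (r / (1 + r))\<^sup>2" using r(1) by (simp add: power_divide pos_le_divide_eq)
  then show ?thesis using r(4) by simp
qed


section \<open>Shifting\<close>

definition replace :: "'a \<Rightarrow> 'a \<Rightarrow> 'a set \<Rightarrow> 'a set" where
  "replace i j F = insert i (F - {j})"

definition shift :: "'a \<Rightarrow> 'a \<Rightarrow> 'a set set \<Rightarrow> 'a set set" where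
  "shift i j G = {F\<in>G. j \<in> F \<and> i \<notin> F \<longrightarrow> replace i j F \<in> G} \<union>
     replace i j ` {F\<in>G. j \<in> F \<and> i \<notin> F}"

lemma replace_replace: "j \<in> F \<Longrightarrow> i \<notin> F \<Longrightarrow> replace j i (replace i j F) = F"
  by (auto simp: replace_def)

lemma card_replace: "finite F \<Longrightarrow> j \<in> F \<Longrightarrow> i \<notin> F \<Longrightarrow> card (replace i j F) = card F"
  by (metis replace_def card_Suc_Diff1 card_insert_disjoint finite_Diff DiffD1)

lemma shift_subset_Pow: "G \<subseteq> Pow V \<Longrightarrow> i \<in> V \<Longrightarrow> shift i j G \<subseteq> Pow V"
  by (auto simp: shift_def replace_def)

definition shift_map :: "'a \<Rightarrow> 'a \<Rightarrow> 'a set set \<Rightarrow> 'a set \<Rightarrow> 'a set" where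
  "shift_map i j G F = (if j \<in> F \<and> i \<notin> F \<and> replace i j F \<notin> G then replace i j F else F)"

lemma bij_betw_shift_map: "bij_betw (shift_map i j G) G (shift i j G)"
proof (rule bij_betw_imageI)
  show "inj_on (shift_map i j G) G"
  proof (rule inj_onI)
    fix E F assume EF: "E \<in> G" "F \<in> G" and eq: "shift_map i j G E = shift_map i j G F"
    have "E = F" if "j \<in> E \<and> i \<notin> E" "j \<in> F \<and> i \<notin> F" "replace i j E = replace i j F"
      using that by (metis replace_replace)
    with EF eq show "E = F" by (auto simp: shift_map_def split: if_splits)
  qed
  show "shift_map i j G ` G = shift i j G"
  proof
    show "shift_map i j G ` G \<subseteq> shift i j G" by (auto simp: shift_map_def shift_def)
    show "shift i j G \<subseteq> shift_map i j G ` G"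
    proof
      fix F assume F: "F \<in> shift i j G"
      show "F \<in> shift_map i j G ` G"
      proof (cases "F \<in> G \<and> (j \<in> F \<and> i \<notin> F \<longrightarrow> replace i j F \<in> G)")
        case True
        then show ?thesis by (intro image_eqI[of _ _ F]) (auto simp: shift_map_def)
      next
        case False
        with F obtain E where E: "E \<in> G" "j \<in> E" "i \<notin> E" "F = replace i j E"
          by (auto simp: shift_def)
        moreover have "j \<notin> F" using E by (auto simp: replace_def)
        ultimately have "F \<notin> G" using False by auto
        with E show ?thesis by (intro image_eqI[of _ _ E]) (auto simp: shift_map_def)
      qed
    qed
  qed
qed

lemma mu_shift:
  assumes "finite V" "G \<subseteq> Pow V"
  shows "mu p V (shift i j G) = mu p V G"
proof -
  have "card (shift_map i j G F) = card F" if "F \<in> G" for F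
    using that assms by (auto simp: shift_map_def card_replace finite_subset)
  then show ?thesis
    unfolding mu_def sum.reindex_bij_betw[OF bij_betw_shift_map[of i j G], symmetric] by simp
qed

lemma sum_shift_less:
  fixes G :: "nat set set"
  assumes "finite V" "G \<subseteq> Pow V" "i < j" "F \<in> G" "j \<in> F" "i \<notin> F" "replace i j F \<notin> G"
  shows "(\<Sum>F\<in>shift i j G. \<Sum>F) < (\<Sum>F\<in>G. \<Sum>F)"
proof -
  have *: "\<Sum>(replace i j E) < \<Sum>E" if "j \<in> E" "i \<notin> E" "E \<in> G" for E
  proof -
    have "finite E" using that assms by (auto intro: finite_subset)
    then have "\<Sum>E = j + \<Sum>(E - {j})" "\<Sum>(replace i j E) = i + \<Sum>(E - {j})"
      using that by (simp_all add: replace_def sum.remove[of E j "\<lambda>x. x"])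
    then show ?thesis using assms(3) by simp
  qed
  have "(\<Sum>F\<in>G. \<Sum>(shift_map i j G F)) < (\<Sum>F\<in>G. \<Sum>F)"
  proof (rule sum_strict_mono_ex1)
    show "finite G" using assms by (auto intro: finite_subset[of _ "Pow V"])
    show "\<forall>F\<in>G. \<Sum>(shift_map i j G F) \<le> \<Sum>F" using * by (auto simp: shift_map_def less_imp_le)
    show "\<exists>F\<in>G. \<Sum>(shift_map i j G F) < \<Sum>F" using * assms by (auto simp: shift_map_def)
  qed
  then show ?thesis using sum.reindex_bij_betw[OF bij_betw_shift_map[of i j G], of "\<lambda>F. \<Sum>F"] by simp
qed

text \<open>Each member \<open>F\<close> of the shifted family is traced back to a member \<open>pre F\<close> of the original one, which
agrees with \<open>F\<close> outside \<open>{i, j}\<close> and contains \<open>j\<close> only if \<open>F\<close> contains \<open>i\<close>. Sending \<open>j\<close> to \<open>i\<close> then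
embeds the intersection of the traced sets into the intersection of the given ones; this is
injective as soon as one of the given sets is new.\<close>

lemma three_wise_shift:
  fixes G :: "nat set set"
  assumes G: "three_wise_intersecting t G" "finite V" "G \<subseteq> Pow V" and "i \<noteq> j"
  shows "three_wise_intersecting t (shift i j G)"
  unfolding three_wise_intersecting_def
proof (intro ballI)
  fix A B C assume ABC: "A \<in> shift i j G" "B \<in> shift i j G" "C \<in> shift i j G"
  show "t \<le> card (A \<inter> B \<inter> C)"
  proof (cases "A \<in> G \<and> B \<in> G \<and> C \<in> G")
    case True
    then show ?thesis using G by (auto simp: three_wise_intersecting_def)
  next
    case False
    define pre where "pre F = (if F \<notin> G then replace j i F else
       if j \<in> F \<and> i \<notin> F then replace i j F else F)" for F
    have pre: "pre F \<in> G \<and> (\<forall>z\<in>pre F. z \<noteq> i \<longrightarrow> (if z = j then i else z) \<in> F) \<and> (F \<notin> G \<longrightarrow> i \<notin> pre F)"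
      if F: "F \<in> shift i j G" for F
    proof (cases "F \<in> G")
      case True
      then have "j \<in> F \<and> i \<notin> F \<longrightarrow> replace i j F \<in> G" using that by (auto simp: shift_def replace_def)
      then show ?thesis using True by (auto simp: pre_def replace_def)
    next
      case False
      then obtain E where E: "E \<in> G" "j \<in> E" "i \<notin> E" "F = replace i j E"
        using F unfolding shift_def by blast
      then have "pre F = E" using False by (simp add: pre_def replace_replace)
      then show ?thesis using E by (auto simp: replace_def)
    qed
    define D where "D = pre A \<inter> pre B \<inter> pre C"
    have "i \<notin> D" using False pre[OF ABC(1)] pre[OF ABC(2)] pre[OF ABC(3)] by (auto simp: D_def)
    have "A \<subseteq> insert i V" using ABC(1) assms(3) by (auto simp: shift_def replace_def)
    then have fin: "finite A" by (rule finite_subset) (simp add: assms(2))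
    have "card D \<le> card (A \<inter> B \<inter> C)"
    proof (rule card_inj_on_le[where f = "\<lambda>z. if z = j then i else z"])
      show "inj_on (\<lambda>z. if z = j then i else z) D" using \<open>i \<notin> D\<close> by (auto simp: inj_on_def)
      show "(\<lambda>z. if z = j then i else z) ` D \<subseteq> A \<inter> B \<inter> C"
      proof (rule image_subsetI)
        fix z assume "z \<in> D"
        then have "z \<in> pre A" "z \<in> pre B" "z \<in> pre C" "z \<noteq> i" using \<open>i \<notin> D\<close> by (auto simp: D_def)
        then show "(if z = j then i else z) \<in> A \<inter> B \<inter> C"
          using pre[OF ABC(1)] pre[OF ABC(2)] pre[OF ABC(3)] by simp
      qed
    qed (use fin in auto)
    moreover have "t \<le> card D"
      using G(1) pre[OF ABC(1)] pre[OF ABC(2)] pre[OF ABC(3)]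
      unfolding three_wise_intersecting_def D_def by simp
    ultimately show ?thesis by simp
  qed
qed


section \<open>Families of sets that almost contain a fixed set\<close>

text \<open>For \<open>card U = t + 3 * s\<close> these are the isomorphic copies of the Frankl families.\<close>

definition near :: "'a set \<Rightarrow> 'a set \<Rightarrow> nat \<Rightarrow> 'a set set" where
  "near V U s = {F. F \<subseteq> V \<and> card (U - F) \<le> s}"

text \<open>Shifting cannot create an extremal family from a family of another kind. In the case \<open>i \<in> U\<close>, \<open>j \<notin> U\<close> the
original family \<open>G\<close> is undetermined only on the critical sets and their images under \<open>i \<mapsto> j\<close>. The critical sets contain \<open>i\<close>, not \<open>j\<close>, and miss
exactly \<open>s\<close> elements of \<open>U\<close>, and at least one of such a set and its image belongs to \<open>G\<close>. If the choices were mixed,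
there would be two sets with opposite choices that miss disjoint parts of \<open>U\<close>, and with a suitable third set
containing \<open>i\<close> and \<open>j\<close> they would have only \<open>t - 1\<close> common elements. So the choice is uniform, and \<open>G\<close> belongs to \<open>U\<close> or to \<open>U\<close> with
\<open>i\<close> replaced by \<open>j\<close>.\<close>

lemma shift_eq_near:
  fixes G :: "nat set set"
  assumes V: "finite V" "G \<subseteq> Pow V" and G: "three_wise_intersecting t G"
    and U: "U \<subseteq> V" "card U = t + 3 * s" "s < t"
    and ij: "i \<noteq> j" "i \<in> V" "j \<in> V" and eq: "shift i j G = near V U s"
  shows "\<exists>U'\<subseteq>V. card U' = card U \<and> G = near V U' s"
proof -
  have finU: "finite U" using U(1) V(1) by (rule finite_subset)
  define crit where "crit F \<longleftrightarrow> F \<subseteq> V \<and> i \<in> F \<and> j \<notin> F \<and> card (U - F) = s" for F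
  have moved: "j \<in> F \<and> i \<notin> F \<and> replace i j F \<notin> G \<and> replace i j F \<in> near V U s \<and> F \<notin> near V U s"
    if "F \<in> G" "F \<notin> near V U s" for F
  proof -
    have "F \<notin> shift i j G" using that eq by simp
    then have "j \<in> F" "i \<notin> F" "replace i j F \<notin> G" using that(1) by (auto simp: shift_def)
    moreover have "replace i j F \<in> shift i j G" using calculation that(1) by (auto simp: shift_def)
    ultimately show ?thesis using eq that by simp
  qed
  have fixed: "F \<in> G" if F: "F \<in> near V U s" "\<not> (i \<in> F \<and> j \<notin> F)" for F
  proof -
    have "F \<notin> replace i j ` {F\<in>G. j \<in> F \<and> i \<notin> F}" using F(2) ij(1) by (auto simp: replace_def)
    then show ?thesis using F(1) unfolding eq[symmetric] shift_def by blast
  qed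
  have image: "F \<in> G \<or> replace j i F \<in> G" if F: "F \<in> near V U s" for F
  proof (cases "F \<in> G")
    case False
    then obtain E where "E \<in> G" "j \<in> E" "i \<notin> E" "F = replace i j E"
      using F unfolding eq[symmetric] shift_def by blast
    then show ?thesis by (simp add: replace_replace)
  qed simp
  have restore: "F \<in> G" if F: "replace j i F \<in> near V U s" "i \<in> F" "j \<notin> F" for F
  proof -
    have *: "j \<in> replace j i F" "i \<notin> replace j i F" using F ij(1) by (auto simp: replace_def)
    then have "replace j i F \<notin> replace i j ` {F\<in>G. j \<in> F \<and> i \<notin> F}"
      using ij(1) by (auto simp: replace_def)
    then have "replace i j (replace j i F) \<in> G"
      using F(1) * unfolding eq[symmetric] shift_def by blast
    then show ?thesis using F by (simp add: replace_replace)
  qed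
  show ?thesis
  proof (cases "i \<in> U \<and> j \<notin> U")
    case False
    have le: "card (U - F) \<le> card (U - replace i j F)" if "j \<in> F" "i \<notin> F" for F
    proof (cases "i \<in> U")
      case True
      then have "U - F = insert i ((U - replace i j F) - {j})" "j \<in> U - replace i j F"
        "i \<notin> U - replace i j F"
        using False that ij by (auto simp: replace_def)
      then show ?thesis using finU card_Suc_Diff1[of "U - replace i j F" j] by simp
    next
      case False
      then show ?thesis using that finU by (intro card_mono) (auto simp: replace_def)
    qed
    have "G \<subseteq> near V U s"
    proof
      fix F assume F: "F \<in> G"
      show "F \<in> near V U s"
      proof (rule ccontr)
        assume n: "F \<notin> near V U s"
        from moved[OF F n] le[of F] F V show False by (auto simp: near_def)
      qed
    qed
    moreover have "near V U s \<subseteq> G"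
    proof
      fix F assume F: "F \<in> near V U s"
      show "F \<in> G"
      proof (rule ccontr)
        assume n: "F \<notin> G"
        then have 1: "replace j i F \<in> G" "i \<in> F" "j \<notin> F" using image F fixed by auto
        then have "replace j i F \<in> near V U s" using \<open>G \<subseteq> near V U s\<close> by auto
        with n 1 restore show False by blast
      qed
    qed
    ultimately show ?thesis using U by auto
  next
    case True
    then have iU: "i \<in> U" and jU: "j \<notin> U" by auto
    have conflict: False
      if "K \<subseteq> U - {i}" "L \<subseteq> U - {i}" "card K = s" "card L = s" "K \<inter> L = {}"
        "A \<in> G" "j \<notin> A" "A \<inter> (U - {i}) = U - {i} - K"
        "B \<in> G" "i \<notin> B" "B \<inter> (U - {i}) = U - {i} - L" for A B K L
    proof -
      have finD: "finite (U - {i})" using finU by (rule finite_Diff)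
      have fin: "finite K" "finite L"
        by (rule finite_subset[OF that(1) finD] finite_subset[OF that(2) finD])+
      have "card (K \<union> L) = 2 * s" using card_Un_disjoint[OF fin that(5)] that(3,4) by simp
      moreover have "card (U - {i}) = t + 3 * s - 1" using card_Diff_singleton[OF iU] U(2) by simp
      moreover have "card (U - {i} - (K \<union> L)) = card (U - {i}) - card (K \<union> L)"
        by (rule card_Diff_subset) (use that(1,2) fin in blast)+
      ultimately have c1: "card (U - {i} - (K \<union> L)) = t + s - 1" using U(3) by simp
      then have "s \<le> card (U - {i} - (K \<union> L))" using U(3) by simp
      then obtain M where M: "M \<subseteq> U - {i} - (K \<union> L)" "card M = s" "finite M"
        by (rule obtain_subset_with_card_n)
      \<comment> \<open>A third set: it contains both \<open>i\<close> and \<open>j\<close>, so the shift does not affect it.\<close>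
      define C where "C = insert j (U - M)"
      have "U - C = M" using M jU by (auto simp: C_def)
      then have "C \<in> near V U s" using U ij M by (auto simp: near_def C_def)
      then have "C \<in> G" by (intro fixed) (auto simp: C_def)
      then have "t \<le> card (A \<inter> B \<inter> C)"
        using G that(6,9) unfolding three_wise_intersecting_def by simp
      also have "A \<inter> B \<inter> C = (A \<inter> (U - {i})) \<inter> (B \<inter> (U - {i})) - M"
        using that(7,10) by (auto simp: C_def)
      also have "\<dots> = U - {i} - (K \<union> L) - M"
        unfolding that(8,11) by auto
      also have "card \<dots> = t - 1" using card_Diff_subset[OF M(3,1)] c1 M(2) by simp
      finally show False using U(3) by simp
    qed
    have dichotomy: "(\<forall>F. crit F \<longrightarrow> F \<in> G) \<or> (\<forall>F. crit F \<longrightarrow> F \<notin> G)"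
    proof (rule ccontr)
      assume "\<not> ?thesis"
      then obtain A B where AB: "crit A" "A \<in> G" "crit B" "B \<notin> G" by blast
      define K L where "K = U - A" and "L = U - B"
      have KL: "K \<subseteq> U - {i}" "L \<subseteq> U - {i}" "card K = s" "card L = s" "finite K" "finite L"
        using AB finU by (auto simp: K_def L_def crit_def)
      have B: "replace j i B \<in> G" using image[of B] AB by (auto simp: near_def crit_def)
      have "card (K \<union> L) \<le> 2 * s" using card_Un_le[of K L] KL by simp
      \<comment> \<open>\<open>K\<close> and \<open>L\<close> may overlap; a set \<open>M\<close> disjoint from both makes a conflict with one of them.\<close>
      then have "s \<le> card (U - {i} - (K \<union> L))"
        using diff_card_le_card_Diff[of "K \<union> L" "U - {i}"] KL iU finU U(2,3) by simp
      then obtain M where M: "M \<subseteq> U - {i} - (K \<union> L)" "card M = s" "finite M"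
        using obtain_subset_with_card_n by metis
      have UM: "U - (U - M) = M" using M by auto
      have near: "U - M \<in> near V U s" using U(1) M UM by (auto simp: near_def)
      show False
      proof (cases "U - M \<in> G")
        case True
        show False
          by (rule conflict[of M L "U - M" "replace j i B"])
            (use M KL B True jU ij in \<open>auto simp: L_def replace_def\<close>)
      next
        case False
        then have "replace j i (U - M) \<in> G" using image near by auto
        then show False
          by (intro conflict[of K M A "replace j i (U - M)"])
            (use M KL AB(1,2) jU ij in \<open>auto simp: K_def replace_def crit_def\<close>)
      qed
    qed
    have Diff1: "U - F = insert i (U - replace i j F)" if "j \<in> F" "i \<notin> F" for F
      using that iU jU ij by (auto simp: replace_def)
    have moved_crit: "crit (replace i j F)" if "F \<in> G" "F \<notin> near V U s" for F
    proof -
      have *: "j \<in> F" "i \<notin> F" "replace i j F \<in> near V U s" using moved that by auto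
      have "card (U - F) = Suc (card (U - replace i j F))"
        using Diff1[OF *(1,2)] finU by (simp add: replace_def)
      moreover have "F \<subseteq> V" using that V by auto
      ultimately show ?thesis using that(2) *(3) ij by (auto simp: near_def crit_def replace_def)
    qed
    show ?thesis
      using dichotomy
    proof
      assume in_G: "\<forall>F. crit F \<longrightarrow> F \<in> G"
      have "G = near V U s"
      proof
        show "G \<subseteq> near V U s" using in_G moved moved_crit by blast
        show "near V U s \<subseteq> G"
        proof
          fix F assume F: "F \<in> near V U s"
          show "F \<in> G"
          proof (rule ccontr)
            assume n: "F \<notin> G"
            then have 1: "replace j i F \<in> G" "i \<in> F" "j \<notin> F" using image F fixed by auto
            have eqF: "replace i j (replace j i F) = F" using 1 by (simp add: replace_replace)
            have "crit F"
            proof (cases "replace j i F \<in> near V U s")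
              case True
              then show ?thesis using n 1 restore by blast
            next
              case False
              then show ?thesis using moved_crit[OF 1(1)] eqF by simp
            qed
            with in_G n show False by simp
          qed
        qed
      qed
      then show ?thesis using U by auto
    next
      assume not_in_G: "\<forall>F. crit F \<longrightarrow> F \<notin> G"
      define U' where "U' = insert j (U - {i})"
      have U': "U' \<subseteq> V" "card U' = card U"
        using U(1) ij iU jU finU by (auto simp: U'_def dest: card_Suc_Diff1)
      have D0: "card (U' - F) = card (U - F)" if "i \<in> F \<longleftrightarrow> j \<in> F" for F
      proof (cases "i \<in> F")
        case True
        then have "U' - F = U - F" using that by (auto simp: U'_def)
        then show ?thesis by simp
      next
        case False
        then have "U' - F = insert j (U - F - {i})" "i \<in> U - F"
          using that iU jU ij by (auto simp: U'_def)
        then show ?thesis using finU jU card_Suc_Diff1[of "U - F" i] by simp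
      qed
      have D1: "U' - F = U - replace i j F" if "j \<in> F" "i \<notin> F" for F
        using that jU by (auto simp: U'_def replace_def)
      have D2: "card (U' - F) = Suc (card (U - F))" if "i \<in> F" "j \<notin> F" for F
      proof -
        have "U' - F = insert j (U - F)" using that by (auto simp: U'_def)
        then show ?thesis using finU jU by simp
      qed
      have "G = near V U' s"
      proof
        show "G \<subseteq> near V U' s"
        proof
          fix F assume F: "F \<in> G"
          then have FV: "F \<subseteq> V" using V by auto
          show "F \<in> near V U' s"
          proof (cases "F \<in> near V U s")
            case True
            have "\<not> crit F" using F not_in_G by auto
            consider "i \<in> F \<longleftrightarrow> j \<in> F" | "i \<in> F" "j \<notin> F" | "i \<notin> F" "j \<in> F" by auto
            then show ?thesis
            proof cases
              case 3
              then have "card (U - replace i j F) \<le> card (U - F)"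
                using finU jU by (intro card_mono) (auto simp: replace_def)
              then show ?thesis using D1[of F] 3 True by (auto simp: near_def)
            qed (use True \<open>\<not> crit F\<close> D0[of F] D2[of F] in \<open>auto simp: near_def crit_def\<close>)
          next
            case False
            with moved[OF F] D1[of F] FV show ?thesis by (auto simp: near_def)
          qed
        qed
        show "near V U' s \<subseteq> G"
        proof
          fix F assume F: "F \<in> near V U' s"
          consider "i \<in> F \<longleftrightarrow> j \<in> F" | "i \<in> F" "j \<notin> F" | "i \<notin> F" "j \<in> F" by auto
          then show "F \<in> G"
          proof cases
            case 1
            then show ?thesis using F D0[of F] by (intro fixed) (auto simp: near_def)
          next
            case 2
            then have lt: "card (U - F) < s" using F D2[of F] by (auto simp: near_def)
            show ?thesis
            proof (rule ccontr)
              assume n: "F \<notin> G"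
              then have r: "replace j i F \<in> G" using image[of F] lt F by (auto simp: near_def)
              have eqF: "replace i j (replace j i F) = F" using 2 by (simp add: replace_replace)
              have "\<not> crit F" using lt by (simp add: crit_def)
              with moved_crit[OF r] eqF have "replace j i F \<in> near V U s" by auto
              then show False using n 2 restore by blast
            qed
          next
            case 3
            show ?thesis
            proof (cases "card (U - F) \<le> s")
              case True
              then show ?thesis using F 3 by (intro fixed) (auto simp: near_def)
            next
              case False
              have "card (U - F) = Suc (card (U - replace i j F))"
                using Diff1[of F] 3 finU by (simp add: replace_def)
              with False F 3 D1[of F] ij have c: "crit (replace i j F)"
                by (auto simp: near_def crit_def replace_def)
              then have "replace j i (replace i j F) \<in> G"
                using not_in_G image[of "replace i j F"] by (auto simp: near_def crit_def)
              then show ?thesis using 3 by (simp add: replace_replace)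
            qed
          qed
        qed
      qed
      then show ?thesis using U' by auto
    qed
  qed
qed

lemma sum_Pow_card_Diff:
  fixes h :: "nat \<Rightarrow> real"
  assumes "finite A"
  shows "(\<Sum>S\<in>Pow A. h (card A - card S)) = (\<Sum>i\<le>card A. real (card A choose i) * h i)"
proof -
  have "(\<Sum>S\<in>Pow A. h (card A - card S)) = (\<Sum>T\<in>Pow A. h (card T))"
  proof (rule sum.reindex_bij_witness[of _ "\<lambda>T. A - T" "\<lambda>S. A - S"])
    fix S assume "S \<in> Pow A"
    then show "h (card (A - S)) = h (card A - card S)"
      using assms by (simp add: card_Diff_subset rev_finite_subset)
  qed auto
  also have "\<dots> = (\<Sum>i\<le>card A. \<Sum>T\<in>{T\<in>Pow A. card T = i}. h (card T))"
    using assms by (intro sum.group[symmetric]) (auto intro: card_mono)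
  also have "\<dots> = (\<Sum>i\<le>card A. real (card A choose i) * h i)"
  proof (intro sum.cong refl)
    fix i
    have "(\<Sum>T\<in>{T\<in>Pow A. card T = i}. h (card T)) = real (card {T\<in>Pow A. card T = i}) * h i"
      by (simp add: sum_constant[symmetric] del: sum_constant)
    then show "(\<Sum>T\<in>{T\<in>Pow A. card T = i}. h (card T)) = real (card A choose i) * h i"
      using n_subsets[OF assms, of i] by simp
  qed
  finally show ?thesis .
qed

lemma mu_near:
  assumes "finite V" "U \<subseteq> V"
  shows "mu p V (near V U s) =
    (\<Sum>i\<le>card U. real (card U choose i) * (p ^ (card U - i) * (1 - p) ^ i * of_bool (i \<le> s)))"
proof -
  have finU: "finite U" using assms(2,1) by (rule finite_subset)
  have V: "U \<union> (V - U) = V" using assms by auto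
  have "mu p V (near V U s) = (\<Sum>S\<in>Pow U. p ^ card S * (1 - p) ^ (card U - card S) *
      mu p (V - U) {X\<in>Pow (V - U). S \<union> X \<in> near V U s})"
    using mu_split[of U "V - U" "near V U s" p] assms finU unfolding V by (auto simp: near_def)
  also have "\<dots> = (\<Sum>S\<in>Pow U. p ^ (card U - (card U - card S)) * (1 - p) ^ (card U - card S)
      * of_bool (card U - card S \<le> s))"
  proof (intro sum.cong refl)
    fix S assume S: "S \<in> Pow U"
    then have finS: "finite S" using finU by (auto intro: rev_finite_subset)
    have "card (U - (S \<union> X)) = card U - card S" if "X \<subseteq> V - U" for X
    proof -
      have "U - (S \<union> X) = U - S" using that by auto
      then show ?thesis using S finS by (simp add: card_Diff_subset)
    qed
    then have "{X\<in>Pow (V - U). S \<union> X \<in> near V U s} = (if card U - card S \<le> s then Pow (V - U) else {})"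
      using S assms(2) by (auto simp: near_def)
    moreover have "mu p (V - U) {} = 0" by (simp add: mu_def)
    moreover have "card S \<le> card U" using S finU by (auto intro: card_mono)
    ultimately show "p ^ card S * (1 - p) ^ (card U - card S) *
        mu p (V - U) {X\<in>Pow (V - U). S \<union> X \<in> near V U s}
      = p ^ (card U - (card U - card S)) * (1 - p) ^ (card U - card S) * of_bool (card U - card S \<le> s)"
      using assms(1) by (simp add: mu_Pow)
  qed
  also have "\<dots> = (\<Sum>i\<le>card U. real (card U choose i) * (p ^ (card U - i) * (1 - p) ^ i * of_bool (i \<le> s)))"
    by (rule sum_Pow_card_Diff[OF finU])
  finally show ?thesis .
qed

lemma mu_near_0:
  assumes "finite V" "U \<subseteq> V"
  shows "mu p V (near V U 0) = p ^ card U"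
proof -
  have "mu p V (near V U 0) = (\<Sum>i\<in>{0}. real (card U choose i) * (p ^ (card U - i) * (1 - p) ^ i * of_bool (i \<le> 0)))"
    unfolding mu_near[OF assms] by (intro sum.mono_neutral_right) auto
  then show ?thesis by simp
qed

lemma mu_near_1:
  assumes "finite V" "U \<subseteq> V" "0 < card U"
  shows "mu p V (near V U 1) = p ^ card U + real (card U) * p ^ (card U - 1) * (1 - p)"
proof -
  have "mu p V (near V U 1) = (\<Sum>i\<in>{0,1}. real (card U choose i) * (p ^ (card U - i) * (1 - p) ^ i * of_bool (i \<le> 1)))"
    unfolding mu_near[OF assms(1,2)] using assms(3) by (intro sum.mono_neutral_right) auto
  then show ?thesis by simp
qed


section \<open>Links of shifted families\<close>

definition shifted_above :: "nat \<Rightarrow> nat set set \<Rightarrow> bool" where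
  "shifted_above k H \<longleftrightarrow> (\<forall>F\<in>H. \<forall>i j. k < i \<and> i < j \<and> j \<in> F \<and> i \<notin> F \<longrightarrow> replace i j F \<in> H)"

definition link :: "nat \<Rightarrow> nat \<Rightarrow> nat set \<Rightarrow> nat set set \<Rightarrow> nat set set" where
  "link k n S G = {X\<in>Pow {k<..n}. S \<union> X \<in> G}"

lemma shifted_above_link:
  assumes "shifted_above m G" "m \<le> k" "S \<subseteq> {m<..k}"
  shows "shifted_above k (link k n S G)"
  unfolding shifted_above_def
proof (intro ballI allI impI)
  fix X i j assume X: "X \<in> link k n S G" and ij: "k < i \<and> i < j \<and> j \<in> X \<and> i \<notin> X"
  then have "i \<notin> S \<union> X" "j \<in> S \<union> X" "S \<union> X \<in> G" using assms(3) by (auto simp: link_def)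
  then have "replace i j (S \<union> X) \<in> G" using assms(1,2) ij by (auto simp: shifted_above_def)
  moreover have "replace i j (S \<union> X) = S \<union> replace i j X" using assms(3) ij by (auto simp: replace_def)
  ultimately show "replace i j X \<in> link k n S G" using X ij by (auto simp: link_def replace_def)
qed

lemma link_link: "k \<le> l \<Longrightarrow> T \<subseteq> {k<..l} \<Longrightarrow> l \<le> n \<Longrightarrow> link l n T (link k n S G) = link l n (S \<union> T) G"
  by (auto simp: link_def Un_assoc)

lemma three_wise_link_in:
  assumes "three_wise_intersecting d H"
  shows "three_wise_intersecting (d - 1) (link (Suc k) n {Suc k} H)"
  unfolding three_wise_intersecting_def
proof (intro ballI)
  fix X Y Z
  assume XYZ: "X \<in> link (Suc k) n {Suc k} H" "Y \<in> link (Suc k) n {Suc k} H" "Z \<in> link (Suc k) n {Suc k} H"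
  then have "insert (Suc k) X \<in> H" "insert (Suc k) Y \<in> H" "insert (Suc k) Z \<in> H"
    by (simp_all add: link_def)
  then have "d \<le> card (insert (Suc k) X \<inter> insert (Suc k) Y \<inter> insert (Suc k) Z)"
    using assms unfolding three_wise_intersecting_def by blast
  also have "insert (Suc k) X \<inter> insert (Suc k) Y \<inter> insert (Suc k) Z = insert (Suc k) (X \<inter> Y \<inter> Z)"
    by auto
  also have "card \<dots> \<le> Suc (card (X \<inter> Y \<inter> Z))" by (rule card_insert_le_m1) auto
  finally show "d - 1 \<le> card (X \<inter> Y \<inter> Z)" by simp
qed

text \<open>In two of the three sets a common element can be shifted down to \<open>Suc k\<close>. The shifted sets are still in
\<open>H\<close>, but \<open>Suc k\<close> is not in the third set, so two common elements are lost without a gain. Hence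
missing the first element costs two further common elements, while containing it saves only one.\<close>

lemma three_wise_link_out:
  assumes "three_wise_intersecting d H" "shifted_above k H" "0 < d"
  shows "three_wise_intersecting (d + 2) (link (Suc k) n {} H)"
  unfolding three_wise_intersecting_def
proof (intro ballI)
  fix X Y Z
  assume XYZ: "X \<in> link (Suc k) n {} H" "Y \<in> link (Suc k) n {} H" "Z \<in> link (Suc k) n {} H"
  define I where "I = X \<inter> Y \<inter> Z"
  have H: "X \<in> H" "Y \<in> H" "Z \<in> H" and sub: "X \<subseteq> {Suc k<..n}" "Y \<subseteq> {Suc k<..n}" "Z \<subseteq> {Suc k<..n}"
    using XYZ by (auto simp: link_def)
  have out: "Suc k \<notin> Y" "Suc k \<notin> Z" using sub by auto
  have finI: "finite I" using finite_subset[OF sub(1)] by (simp add: I_def)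
  have move: "replace (Suc k) a W \<in> H" if "a \<in> W" "W \<in> H" "W \<subseteq> {Suc k<..n}" for a W
  proof -
    have "k < Suc k \<and> Suc k < a \<and> a \<in> W \<and> Suc k \<notin> W" using that(1,3) by auto
    then show ?thesis using assms(2) that(2) unfolding shifted_above_def by blast
  qed
  have d: "d \<le> card (A \<inter> B \<inter> C)" if "A \<in> H" "B \<in> H" "C \<in> H" for A B C
    using assms(1) that by (simp add: three_wise_intersecting_def)
  have "I \<noteq> {}" using d[OF H] assms(3) by (auto simp: I_def)
  then obtain a where a: "a \<in> I" by auto
  have mX: "replace (Suc k) a X \<in> H" using a H sub by (intro move) (auto simp: I_def)
  have "replace (Suc k) a X \<inter> Y \<inter> Z = I - {a}" using out by (auto simp: I_def replace_def)
  with d[OF mX H(2,3)] have "d \<le> card (I - {a})" by simp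
  with assms(3) have "0 < card (I - {a})" by (rule less_le_trans)
  then have "I - {a} \<noteq> {}" unfolding card_gt_0_iff ..
  then obtain b where b: "b \<in> I - {a}" by blast
  have mY: "replace (Suc k) b Y \<in> H" using b H sub by (intro move) (auto simp: I_def)
  have "replace (Suc k) a X \<inter> replace (Suc k) b Y \<inter> Z = I - {a} - {b}"
    using out by (auto simp: I_def replace_def)
  with d[OF mX mY H(3)] have "d \<le> card (I - {a} - {b})" by simp
  also have "card (I - {a} - {b}) = card I - 2" using a b finI by simp
  finally show "d + 2 \<le> card (X \<inter> Y \<inter> Z)" using assms(3) by (simp add: I_def)
qed

lemma mu_link_step:
  assumes "k < n" "H \<subseteq> Pow {k<..n}"
  shows "mu p {k<..n} H = p * mu p {Suc k<..n} (link (Suc k) n {Suc k} H)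
    + (1 - p) * mu p {Suc k<..n} (link (Suc k) n {} H)"
proof -
  have "{k<..n} = insert (Suc k) {Suc k<..n}" using assms(1) by auto
  then show ?thesis using mu_insert[of "{Suc k<..n}" "Suc k" H p] assms(2) by (simp add: link_def)
qed

lemma three_wise_Pow_empty:
  assumes "three_wise_intersecting d H" "H \<subseteq> Pow {}" "0 < d"
  shows "H = {}"
proof (rule ccontr)
  assume "H \<noteq> {}"
  then have "{} \<in> H" using assms(2) by auto
  then have "d \<le> card ({} \<inter> {} \<inter> {} :: nat set)"
    using assms(1) unfolding three_wise_intersecting_def by blast
  then show False using assms(3) by simp
qed

text \<open>Containing the first element lowers \<open>d\<close> by 1, missing it raises \<open>d\<close> by 2. So the measure is at
most the probability that a walk which goes down 1 with probability \<open>p\<close> and up 2 otherwise ever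
descends by \<open>d\<close>, and \<open>\<alpha> ^ d\<close> bounds this for every supersolution \<open>\<alpha>\<close> of \<open>\<alpha> = p + (1 - p) \<alpha>\<^sup>3\<close>.\<close>

lemma mu_shifted_le:
  assumes "H \<subseteq> Pow {k<..n}" "shifted_above k H" "three_wise_intersecting d H"
    and p: "0 \<le> p" "p \<le> 1" and \<alpha>: "0 \<le> \<alpha>" "p + (1 - p) * \<alpha> ^ 3 \<le> \<alpha>"
  shows "mu p {k<..n} H \<le> \<alpha> ^ d"
  using assms(1-3)
proof (induction "n - k" arbitrary: k d H)
  case 0
  then have "{k<..n} = {}" by simp
  with 0 p \<alpha> show ?case
    using three_wise_Pow_empty[of d H] mu_le_1[of "{k<..n}" H p] by (cases "d = 0") (auto simp: mu_def)
next
  case (Suc m)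
  show ?case
  proof (cases d)
    case 0
    then show ?thesis using mu_le_1[of "{k<..n}" H p] Suc.prems p by simp
  next
    case (Suc e)
    have m: "m = n - Suc k" "k < n" using Suc.hyps(2) by auto
    have sub: "link (Suc k) n S H \<subseteq> Pow {Suc k<..n}" for S by (auto simp: link_def)
    have shift: "shifted_above (Suc k) (link (Suc k) n S H)" if "S \<subseteq> {k<..Suc k}" for S
      using Suc.prems(2) that by (intro shifted_above_link[of k]) auto
    have 1: "mu p {Suc k<..n} (link (Suc k) n {Suc k} H) \<le> \<alpha> ^ e"
      using three_wise_link_in[OF Suc.prems(3)] Suc
      by (intro Suc.hyps(1)[OF m(1) sub shift]) auto
    have 2: "mu p {Suc k<..n} (link (Suc k) n {} H) \<le> \<alpha> ^ (d + 2)"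
      using three_wise_link_out[OF Suc.prems(3,2)] Suc
      by (intro Suc.hyps(1)[OF m(1) sub shift]) auto
    have "mu p {k<..n} H \<le> p * \<alpha> ^ e + (1 - p) * \<alpha> ^ (d + 2)"
      unfolding mu_link_step[OF m(2) Suc.prems(1)] using 1 2 p
      by (intro add_mono mult_left_mono) auto
    also have "\<dots> = \<alpha> ^ e * (p + (1 - p) * \<alpha> ^ 3)"
      using Suc by (simp add: algebra_simps power_add eval_nat_numeral)
    also have "\<dots> \<le> \<alpha> ^ e * \<alpha>" using \<alpha> by (intro mult_left_mono) auto
    finally show ?thesis using Suc by (simp add: mult.commute)
  qed
qed

text \<open>The counting of the two link lemmas, iterated along an initial segment no longer than \<open>t\<close>.
Before its end the level of intersection stays positive, so each missed element does raise it by two.\<close>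

lemma three_wise_link_prefix:
  assumes "shifted_above 0 G" "three_wise_intersecting t G" "S \<subseteq> {1..k}" "k \<le> t" "k \<le> n"
  shows "three_wise_intersecting (t - k + 3 * card ({1..k} - S)) (link k n S G)"
  using assms(3-5)
proof (induction k arbitrary: S)
  case 0
  then show ?case using assms(2) by (auto simp: three_wise_intersecting_def link_def)
next
  case (Suc k)
  define S' where "S' = S \<inter> {1..k}"
  have IH: "three_wise_intersecting (t - k + 3 * card ({1..k} - S')) (link k n S' G)"
    using Suc.prems by (intro Suc.IH) (auto simp: S'_def)
  show ?case
  proof (cases "Suc k \<in> S")
    case True
    have S: "S' \<union> {Suc k} = S" using True Suc.prems(1) by (auto simp: S'_def le_Suc_eq)
    have "{1..Suc k} - S = {1..k} - S'" using True by (auto simp: S'_def le_Suc_eq)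
    moreover have "link (Suc k) n {Suc k} (link k n S' G) = link (Suc k) n S G"
      using S Suc.prems by (subst link_link) auto
    ultimately show ?thesis using three_wise_link_in[OF IH, of k n] Suc.prems(2) by (simp add: Suc_diff_Suc)
  next
    case False
    have S: "S' = S" using False Suc.prems(1) by (auto simp: S'_def le_Suc_eq)
    have "{1..Suc k} - S = insert (Suc k) ({1..k} - S')" using False by (auto simp: S'_def le_Suc_eq)
    then have card: "card ({1..Suc k} - S) = Suc (card ({1..k} - S'))" by simp
    have "link (Suc k) n {} (link k n S' G) = link (Suc k) n S G"
      using S Suc.prems by (subst link_link) auto
    moreover have "shifted_above k (link k n S' G)"
      using assms(1) by (intro shifted_above_link[of 0]) (auto simp: S'_def)
    moreover have "0 < t - k + 3 * card ({1..k} - S')" using Suc.prems(2) by simp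
    ultimately have "three_wise_intersecting (t - k + 3 * card ({1..k} - S') + 2) (link (Suc k) n S G)"
      using three_wise_link_out[OF IH, of k n] by simp
    moreover have "t - k + 3 * card ({1..k} - S') + 2 = t - Suc k + 3 * card ({1..Suc k} - S)"
      unfolding card using Suc.prems(2) by simp
    ultimately show ?thesis by simp
  qed
qed

text \<open>In the walk picture \<open>p ^ 3\<close> is the probability of descending by three at once. On this event alone
the estimate by 1 is replaced by \<open>M\<close>.\<close>

lemma mu_three_wise_3_le:
  assumes "H \<subseteq> Pow {k<..n}" "shifted_above k H" "three_wise_intersecting 3 H" "k + 3 \<le> n"
    and p: "0 \<le> p" "p \<le> 1" and \<alpha>: "0 \<le> \<alpha>" "p + (1 - p) * \<alpha> ^ 3 \<le> \<alpha>"
    and M: "mu p {k + 3<..n} (link (k + 3) n {k + 1, k + 2, k + 3} H) \<le> M"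
  shows "mu p {k<..n} H \<le> \<alpha> ^ 3 - p ^ 3 + p ^ 3 * M"
proof -
  define H1 where "H1 = link (Suc k) n {Suc k} H"
  define H2 where "H2 = link (Suc (Suc k)) n {Suc (Suc k)} H1"
  define H3 where "H3 = link (Suc (Suc (Suc k))) n {Suc (Suc (Suc k))} H2"
  have sub: "link l n S F \<subseteq> Pow {l<..n}" for l S F by (auto simp: link_def)
  have s1: "shifted_above (Suc k) H1"
    unfolding H1_def by (rule shifted_above_link[OF assms(2)]) auto
  have s2: "shifted_above (Suc (Suc k)) H2"
    unfolding H2_def by (rule shifted_above_link[OF s1]) auto
  have t1: "three_wise_intersecting 2 H1" and t2: "three_wise_intersecting 1 H2"
    using three_wise_link_in[OF assms(3), of k n] three_wise_link_in[of 2 H1 "Suc k" n]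
    by (simp_all add: H1_def H2_def)
  have out: "mu p {Suc l<..n} (link (Suc l) n {} F) \<le> \<alpha> ^ (d + 2)"
    if "shifted_above l F" "three_wise_intersecting d F" "0 < d" for l F d
    using that by (intro mu_shifted_le sub three_wise_link_out p \<alpha> shifted_above_link[of l]) auto
  have "H3 = link (k + 3) n {k + 1, k + 2, k + 3} H"
  proof -
    have "H3 = link (k + 3) n {k + 3} H2" by (simp add: H3_def eval_nat_numeral)
    also have "\<dots> = link (k + 3) n ({k + 2} \<union> {k + 3}) H1"
      using link_link[of "k + 2" "k + 3" "{k + 3}" n "{k + 2}" H1] assms(4) by (simp add: H2_def)
    also have "\<dots> = link (k + 3) n ({k + 1} \<union> ({k + 2} \<union> {k + 3})) H"
      using link_link[of "k + 1" "k + 3" "{k + 2} \<union> {k + 3}" n "{k + 1}" H] assms(4) by (simp add: H1_def)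
    finally show ?thesis by (simp add: insert_commute)
  qed
  then have m3: "mu p {k + 3<..n} H3 \<le> M" using M by simp
  have "mu p {k<..n} H = p * mu p {Suc k<..n} H1 + (1 - p) * mu p {Suc k<..n} (link (Suc k) n {} H)"
    unfolding H1_def using assms(1,4) by (intro mu_link_step) auto
  moreover have "mu p {Suc k<..n} H1 = p * mu p {Suc (Suc k)<..n} H2
    + (1 - p) * mu p {Suc (Suc k)<..n} (link (Suc (Suc k)) n {} H1)"
    unfolding H2_def using assms(4) by (intro mu_link_step) (auto simp: H1_def link_def)
  moreover have "mu p {Suc (Suc k)<..n} H2 = p * mu p {k + 3<..n} H3
    + (1 - p) * mu p {k + 3<..n} (link (k + 3) n {} H2)"
    using assms(4) mu_link_step[of "Suc (Suc k)" n H2 p]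
    by (auto simp: H3_def H2_def link_def eval_nat_numeral)
  ultimately have "mu p {k<..n} H = p ^ 3 * mu p {k + 3<..n} H3
    + ((1 - p) * mu p {Suc k<..n} (link (Suc k) n {} H)
      + p * (1 - p) * mu p {Suc (Suc k)<..n} (link (Suc (Suc k)) n {} H1)
      + p\<^sup>2 * (1 - p) * mu p {k + 3<..n} (link (k + 3) n {} H2))"
    by (simp add: algebra_simps power2_eq_square power3_eq_cube)
  also have "\<dots> \<le> p ^ 3 * M + ((1 - p) * \<alpha> ^ 5 + p * (1 - p) * \<alpha> ^ 4 + p\<^sup>2 * (1 - p) * \<alpha> ^ 3)"
    using out[OF assms(2,3)] out[OF s1 t1] out[OF s2 t2] m3 p
    by (intro add_mono mult_left_mono) (auto simp: eval_nat_numeral)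
  also have "(1 - p) * \<alpha> ^ 5 + p * (1 - p) * \<alpha> ^ 4 + p\<^sup>2 * (1 - p) * \<alpha> ^ 3
    = (\<alpha>\<^sup>2 + p * \<alpha> + p\<^sup>2) * ((1 - p) * \<alpha> ^ 3)"
    by (simp add: algebra_simps eval_nat_numeral)
  also have "\<dots> \<le> (\<alpha>\<^sup>2 + p * \<alpha> + p\<^sup>2) * (\<alpha> - p)"
    using p \<alpha> by (intro mult_left_mono) auto
  also have "\<dots> = \<alpha> ^ 3 - p ^ 3" by (simp add: algebra_simps power2_eq_square power3_eq_cube)
  finally show ?thesis by simp
qed


section \<open>Holes\<close>

definition up_closed :: "'a set \<Rightarrow> 'a set set \<Rightarrow> bool" where
  "up_closed V G \<longleftrightarrow> (\<forall>F\<in>G. \<forall>E. F \<subseteq> E \<and> E \<subseteq> V \<longrightarrow> E \<in> G)"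

text \<open>Shifting an element down into a hole moves the hole up. Among the \<open>m\<close>-element subsets of \<open>{1..k}\<close> that
can be the set of holes of a member, one of maximal sum must therefore be the top interval.\<close>

lemma holes_at_top:
  assumes G: "up_closed {1..n} G" "shifted_above 0 G"
    and F: "F \<in> G" "F \<subseteq> {1..n}" "k \<le> n" "m \<le> card ({1..k} - F)"
  shows "{1..n} - {k - m<..k} \<in> G"
proof -
  define \<K> where "\<K> = {K. K \<subseteq> {1..k} \<and> card K = m \<and> {1..n} - K \<in> G}"
  obtain K0 where K0: "K0 \<subseteq> {1..k} - F" "card K0 = m"
    using obtain_subset_with_card_n[OF F(4)] by metis
  have "F \<subseteq> {1..n} - K0" using K0 F(2) by auto
  then have "{1..n} - K0 \<in> G" using G(1) F(1) unfolding up_closed_def by blast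
  then have "K0 \<in> \<K>" using K0 by (auto simp: \<K>_def)
  moreover have fin: "finite \<K>" by (rule finite_subset[of _ "Pow {1..k}"]) (auto simp: \<K>_def)
  ultimately have "Max (Sum ` \<K>) \<in> Sum ` \<K>" by (intro Max_in) auto
  then obtain K where K: "K \<in> \<K>" "\<Sum>K = Max (Sum ` \<K>)" by auto
  have max: "\<Sum>L \<le> \<Sum>K" if "L \<in> \<K>" for L using that fin unfolding K(2) by simp
  have sub: "K \<subseteq> {1..k}" and card: "card K = m" and in_G: "{1..n} - K \<in> G"
    using K(1) by (auto simp: \<K>_def)
  have finK: "finite K" by (rule finite_subset[OF sub]) simp
  have "m \<le> k" using card_mono[OF _ sub] card by simp
  then have cardI: "card {k - m<..k} = m" by simp
  have "K = {k - m<..k}"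
  proof (rule ccontr)
    assume neq: "K \<noteq> {k - m<..k}"
    have "\<not> K \<subseteq> {k - m<..k}"
      using card_subset_eq[of "{k - m<..k}" K] neq cardI card by auto
    moreover have "\<not> {k - m<..k} \<subseteq> K"
      using card_subset_eq[OF finK, of "{k - m<..k}"] neq cardI card by auto
    ultimately obtain a b where ab: "a \<in> K" "a \<notin> {k - m<..k}" "b \<notin> K" "b \<in> {k - m<..k}" by blast
    then have less: "0 < a" "a < b" "b \<le> k" using sub by auto
    have "replace a b ({1..n} - K) \<in> G"
      using G(2) in_G ab less F(3) unfolding shifted_above_def by auto
    moreover have "replace a b ({1..n} - K) = {1..n} - insert b (K - {a})"
      using ab less F(3) by (auto simp: replace_def)
    ultimately have "insert b (K - {a}) \<in> \<K>"
      using sub card ab less finK card_Suc_Diff1[OF finK ab(1)] by (auto simp: \<K>_def)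
    then have "\<Sum>(insert b (K - {a})) \<le> \<Sum>K" by (rule max)
    moreover have "\<Sum>(insert b (K - {a})) = b + \<Sum>(K - {a})" using ab finK by simp
    moreover have "\<Sum>K = a + \<Sum>(K - {a})" using ab finK by (simp add: sum.remove[of K a])
    ultimately show False using less by simp
  qed
  then show ?thesis using in_G by simp
qed

text \<open>A hole in \<open>{1..t}\<close> can be moved to each of \<open>t\<close>, \<open>t + 1\<close>, \<open>t + 2\<close>. If these exhaust the ground
set above \<open>t - 1\<close>, the three resulting members have only \<open>t - 1\<close> common elements.\<close>

lemma ground_set_large:
  assumes G: "up_closed {1..n} G" "shifted_above 0 G" "three_wise_intersecting t G"
    and F: "F \<in> G" "F \<subseteq> {1..n}" "\<not> {1..t} \<subseteq> F" and t: "1 \<le> t" "t \<le> n"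
  shows "t + 3 \<le> n"
proof (rule ccontr)
  assume small: "\<not> t + 3 \<le> n"
  have in_G: "{1..n} - {k} \<in> G" if "t \<le> k" "k \<le> n" for k
  proof -
    have "{1..k} - F \<noteq> {}" using F(3) that by fastforce
    then have "1 \<le> card ({1..k} - F)" by (simp add: Suc_le_eq card_gt_0_iff)
    moreover have "{k - 1<..k} = {k}" using that t by auto
    ultimately show ?thesis using holes_at_top[OF G(1,2) F(1,2) that(2), of 1] by simp
  qed
  have "t \<le> card (({1..n} - {t}) \<inter> ({1..n} - {min n (t + 1)}) \<inter> ({1..n} - {min n (t + 2)}))"
    using G(3) in_G[of t] in_G[of "min n (t + 1)"] in_G[of "min n (t + 2)"] t
    unfolding three_wise_intersecting_def by simp
  also have "\<dots> \<le> card {1..<t}" using small t by (intro card_mono) auto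
  finally show False using t by simp
qed

lemma link_full_intersecting:
  assumes G: "three_wise_intersecting t G" and K: "K \<subseteq> {1..t}" "{1..n} - K \<in> G" and t: "t \<le> n"
    and XY: "X \<in> link t n {1..t} G" "Y \<in> link t n {1..t} G"
  shows "card K \<le> card (X \<inter> Y)"
proof -
  have sub: "X \<subseteq> {t<..n}" "Y \<subseteq> {t<..n}" using XY by (auto simp: link_def)
  have finK: "finite K" by (rule finite_subset[OF K(1)]) simp
  have finX: "finite (X \<inter> Y)" using finite_subset[OF sub(1)] by simp
  have "t \<le> card (({1..t} \<union> X) \<inter> ({1..t} \<union> Y) \<inter> ({1..n} - K))"
    using G K(2) XY unfolding three_wise_intersecting_def link_def by simp
  also have "({1..t} \<union> X) \<inter> ({1..t} \<union> Y) \<inter> ({1..n} - K) = ({1..t} - K) \<union> (X \<inter> Y)"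
  proof -
    have "{1..t} \<subseteq> {1..n}" "X \<subseteq> {1..n}" "X \<inter> {1..t} = {}" "Y \<inter> {1..t} = {}" using sub t by auto
    then show ?thesis using K(1) by blast
  qed
  also have "card \<dots> \<le> card ({1..t} - K) + card (X \<inter> Y)" by (rule card_Un_le)
  also have "card ({1..t} - K) = t - card K" using K(1) finK by (simp add: card_Diff_subset)
  finally show ?thesis using card_mono[OF _ K(1)] by simp
qed

text \<open>The single hole \<open>a\<close> of two members can be moved to the different places \<open>h1\<close> and \<open>h2\<close>. Together with
\<open>K\<close> this removes \<open>card K + 2\<close> of the first \<open>t + 3\<close> elements, and the tails have to make up for
\<open>card K - 1\<close> of them.\<close>

lemma link_one_hole_intersecting:
  assumes G: "three_wise_intersecting t G" "shifted_above 0 G"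
    and K: "K \<subseteq> {1..t + 3}" "{1..n} - K \<in> G" and t: "t + 3 \<le> n"
    and h: "h1 \<in> {t..t + 3} - K" "h2 \<in> {t..t + 3} - K" "h1 \<noteq> h2" and a: "a \<in> {1..t}"
    and XY: "X \<in> link (t + 3) n ({1..t + 3} - {a}) G" "Y \<in> link (t + 3) n ({1..t + 3} - {a}) G"
  shows "card K \<le> card (X \<inter> Y) + 1"
proof -
  have sub: "X \<subseteq> {t + 3<..n}" "Y \<subseteq> {t + 3<..n}" using XY by (auto simp: link_def)
  have move: "({1..t + 3} - {h}) \<union> Z \<in> G"
    if "h \<in> {t..t + 3}" "Z \<in> link (t + 3) n ({1..t + 3} - {a}) G" for h Z
  proof (cases "h = a")
    case True
    then show ?thesis using that(2) by (simp add: link_def)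
  next
    case False
    have Z: "({1..t + 3} - {a}) \<union> Z \<in> G" "Z \<subseteq> {t + 3<..n}" using that(2) by (simp_all add: link_def)
    have mem: "a \<in> {1..t + 3}" "h \<in> {1..t + 3}" "0 < a" "a < h"
      using a that(1) False by simp_all
    have notin: "a \<notin> Z" "h \<notin> Z" using mem subsetD[OF Z(2), of a] subsetD[OF Z(2), of h] by auto
    have "0 < a \<and> a < h \<and> h \<in> ({1..t + 3} - {a}) \<union> Z \<and> a \<notin> ({1..t + 3} - {a}) \<union> Z"
      using mem notin by simp
    then have "replace a h (({1..t + 3} - {a}) \<union> Z) \<in> G"
      by (rule G(2)[unfolded shifted_above_def, rule_format, OF Z(1)])
    also have "replace a h (({1..t + 3} - {a}) \<union> Z) = ({1..t + 3} - {h}) \<union> Z"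
      using mem notin by (auto simp: replace_def)
    finally show ?thesis .
  qed
  have finK: "finite K" by (rule finite_subset[OF K(1)]) simp
  have cardK: "card (insert h1 (insert h2 K)) = card K + 2" using h finK by simp
  have hK: "insert h1 (insert h2 K) \<subseteq> {1..t + 3}" 
  proof -
    have "h1 \<in> {1..t + 3}" "h2 \<in> {1..t + 3}" using h a by simp_all
    then show ?thesis using K(1) by blast
  qed
  have "({1..t + 3} - {h1}) \<union> X \<in> G" by (rule move[OF _ XY(1)]) (use h in blast)
  moreover have "({1..t + 3} - {h2}) \<union> Y \<in> G" by (rule move[OF _ XY(2)]) (use h in blast)
  ultimately have "t \<le> card ((({1..t + 3} - {h1}) \<union> X) \<inter> (({1..t + 3} - {h2}) \<union> Y) \<inter> ({1..n} - K))"
    using G(1)[unfolded three_wise_intersecting_def] K(2) by simp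
  also have "(({1..t + 3} - {h1}) \<union> X) \<inter> (({1..t + 3} - {h2}) \<union> Y) \<inter> ({1..n} - K)
      = ({1..t + 3} - insert h1 (insert h2 K)) \<union> (X \<inter> Y)"
  proof -
    have "{1..t + 3} \<subseteq> {1..n}" "X \<subseteq> {1..n}" "X \<inter> {1..t + 3} = {}" "Y \<inter> {1..t + 3} = {}"
      using sub t by auto
    then show ?thesis using hK by blast
  qed
  also have "card \<dots> \<le> card ({1..t + 3} - insert h1 (insert h2 K)) + card (X \<inter> Y)" by (rule card_Un_le)
  also have "card ({1..t + 3} - insert h1 (insert h2 K)) = t + 3 - (card K + 2)"
    using card_Diff_subset[OF _ hK] finK cardK by simp
  finally show ?thesis using card_mono[OF _ hK] cardK by simp
qed

section \<open>Numerical estimates\<close>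

lemma p0_pos: "1 \<le> t \<Longrightarrow> 0 < p0 t"
proof -
  assume "1 \<le> t"
  then have "sqrt 9 < sqrt (4 * real t + 9)" by (intro real_sqrt_less_mono) simp
  then have "3 < sqrt (4 * real t + 9)" by (simp add: real_sqrt_unique[of 3])
  then show ?thesis by (simp add: p0_def)
qed

text \<open>This equation says that the second Frankl family has measure exactly \<open>p ^ t\<close> at \<open>p = p0 t\<close>.\<close>

lemma p0_equation:
  assumes "1 \<le> t"
  shows "(real t + 2) * (p0 t)\<^sup>2 = 1 + p0 t"
proof -
  define u where "u = sqrt (4 * real t + 9) - 1"
  have p: "p0 t = 2 / u" by (simp add: p0_def u_def)
  have u: "u \<noteq> 0" using p0_pos[OF assms] by (auto simp: p)
  have "(u + 1)\<^sup>2 = 4 * real t + 9" by (simp add: u_def)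
  then have "(real t + 2) * 4 = u * u + 2 * u" by (simp add: power2_eq_square algebra_simps)
  then have "(real t + 2) * (p0 t)\<^sup>2 = (u * u + 2 * u) / (u * u)"
    by (simp add: p power_divide power2_eq_square)
  also have "\<dots> = 1 + p0 t" using u by (simp add: p add_divide_distrib)
  finally show ?thesis .
qed

lemma p0_characterization:
  assumes "1 \<le> t" "0 < p" "p \<le> p0 t"
  shows "(real t + 2) * p\<^sup>2 \<le> 1 + p" and "(real t + 2) * p\<^sup>2 = 1 + p \<Longrightarrow> p = p0 t"
proof -
  define a where "a = real t + 2"
  define r where "r = p0 t"
  have r: "a * r\<^sup>2 = 1 + r" "0 < r" "p \<le> r" using p0_equation p0_pos assms by (auto simp: a_def r_def)
  have id: "r * (1 + p - a * p\<^sup>2) = (r - p) * (1 + a * p * r) + p * (1 + r - a * r\<^sup>2) "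
    by (simp add: algebra_simps power2_eq_square)
  have pos: "0 < 1 + a * p * r" using r assms by (simp add: a_def add_pos_nonneg)
  have "0 \<le> r * (1 + p - a * p\<^sup>2)" unfolding id using r pos by simp
  then have "0 \<le> 1 + p - a * p\<^sup>2" using r(2) by (simp add: zero_le_mult_iff)
  then show "(real t + 2) * p\<^sup>2 \<le> 1 + p" by (simp add: a_def)
  show "p = p0 t" if "(real t + 2) * p\<^sup>2 = 1 + p"
  proof -
    have "(r - p) * (1 + a * p * r) = 0" using id r(1) that by (simp add: a_def)
    then show ?thesis using pos by (simp add: r_def)
  qed
qed


locale small_bias =
  fixes t :: nat and p :: real
  assumes t: "15 \<le> t" and p: "0 < p" and tp: "(real t + 2) * p\<^sup>2 \<le> 1 + p"
begin

text \<open>In units of \<open>p ^ t\<close>: \<open>c\<close> is the weight of the sets with exactly one hole in \<open>{1..t}\<close> whose next three elements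
are present, and \<open>\<beta>\<close> is an explicit upper bound for \<open>\<alpha> / p\<close>, where \<open>\<alpha>\<close> is the smallest positive root
of \<open>\<alpha> = p + (1 - p) \<alpha>\<^sup>3\<close>. In terms of \<open>\<beta>\<close> the equation reads \<open>\<beta> = 1 + x \<beta>\<^sup>3\<close>, with the power series
\<open>1 + x + 3 x\<^sup>2 + \<dots>\<close>; rounding the coefficient 3 up to 4 absorbs the rest of the series.\<close>

definition "x = p\<^sup>2 * (1 - p)"
definition "c = real t * x"
definition "\<beta> = 1 + x + 4 * x\<^sup>2"

text \<open>The positive root of \<open>17 * p\<^sup>2 = 1 + p\<close>, which is \<open>p0 15\<close>, is about 0.27373.\<close>

lemma p_bound: "p \<le> 0.2738"
proof (rule ccontr)
  assume neg: "\<not> ?thesis"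
  have "17 * p\<^sup>2 \<le> (real t + 2) * p\<^sup>2" using t by (intro mult_right_mono) auto
  then have 1: "17 * p\<^sup>2 \<le> 1 + p" using tp by simp
  have "0.2738 * p < p * p" using neg p by (intro mult_strict_right_mono) auto
  then have "17 * (0.2738 * p) < 1 + p" using 1 by (simp add: power2_eq_square)
  then show False using neg by simp
qed

lemma p_le: "p \<le> 1/3" "p \<le> 1/2" "p < 1" "0 \<le> p" "p \<le> 1" using p p_bound by auto

lemma x_pos: "0 < x" using p p_le by (simp add: x_def)

lemma x_bound: "x \<le> 0.0545"
proof -
  \<comment> \<open>\<open>x\<close> grows with \<open>p\<close> on this range, so its value at the bound for \<open>p\<close> is an upper bound.\<close>
  define a :: real where "a = 0.2738"
  have "0 \<le> (a - p) * (p * (1 - a - p) + a * (1 - a))"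
    using p p_bound by (intro mult_nonneg_nonneg add_nonneg_nonneg) (auto simp: a_def)
  also have "\<dots> = a\<^sup>2 * (1 - a) - x" by (simp add: x_def algebra_simps power2_eq_square)
  finally show ?thesis by (simp add: a_def power2_eq_square)
qed

lemma c_pos: "0 < c" using x_pos t by (simp add: c_def)

lemma c_le: "c \<le> (1 - p)\<^sup>2 * (1 + 2 * p)"
proof -
  have "real t * p\<^sup>2 * (1 - p) \<le> (1 + p - 2 * p\<^sup>2) * (1 - p)"
    using tp p_le by (intro mult_right_mono) (auto simp: algebra_simps)
  then show ?thesis by (simp add: c_def x_def algebra_simps power2_eq_square)
qed

lemma \<beta>_pos: "0 < \<beta>" using x_pos by (simp add: \<beta>_def add_pos_pos)

lemma \<beta>_cube_le: "\<beta> ^ 3 \<le> 1 + 4 * x"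
proof -
  define w where "w = 1 + 4 * x"
  have w: "0 \<le> w" "w \<le> 1.218" using x_pos x_bound by (auto simp: w_def)
  have "\<beta> = 1 + x * w" by (simp add: \<beta>_def w_def algebra_simps power2_eq_square)
  then have "\<beta> ^ 3 = 1 + 3 * (x * w) + 3 * (x * w)\<^sup>2 + (x * w) ^ 3"
    by (simp add: power2_eq_square power3_eq_cube distrib_left distrib_right)
  also have "3 * (x * w) = 3 * x + x * (12 * x)" by (simp add: w_def algebra_simps)
  also have "1 + (3 * x + x * (12 * x)) + 3 * (x * w)\<^sup>2 + (x * w) ^ 3
      = 1 + 3 * x + x * (12 * x + 3 * (x * w\<^sup>2) + x\<^sup>2 * w ^ 3)"
    by (simp add: power2_eq_square power3_eq_cube distrib_left mult_ac)
  finally have eq: "\<beta> ^ 3 = 1 + 3 * x + x * (12 * x + 3 * (x * w\<^sup>2) + x\<^sup>2 * w ^ 3)" .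
  have "w\<^sup>2 \<le> 1.218\<^sup>2" "w ^ 3 \<le> 1.218 ^ 3" "x\<^sup>2 \<le> 0.0545\<^sup>2"
    using w x_pos x_bound by (intro power_mono; simp)+
  then have 1: "w\<^sup>2 \<le> 1.5" "w ^ 3 \<le> 2" "x\<^sup>2 \<le> 0.01" by (auto simp: power2_eq_square power3_eq_cube)
  have "x * w\<^sup>2 \<le> 0.0545 * 1.5" using 1 x_bound x_pos by (intro mult_mono) auto
  moreover have "x\<^sup>2 * w ^ 3 \<le> 0.01 * 2" using 1 w by (intro mult_mono) auto
  ultimately have "12 * x + 3 * (x * w\<^sup>2) + x\<^sup>2 * w ^ 3 \<le> 1" using x_bound by simp
  then have "x * (12 * x + 3 * (x * w\<^sup>2) + x\<^sup>2 * w ^ 3) \<le> x * 1"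
    using x_pos by (intro mult_left_mono) auto
  then show ?thesis unfolding eq by simp
qed

lemma \<beta>_recursion: "1 + x * \<beta> ^ 3 \<le> \<beta>"
proof -
  have "x * \<beta> ^ 3 \<le> x * (1 + 4 * x)" using \<beta>_cube_le x_pos by (intro mult_left_mono) auto
  then show ?thesis by (simp add: \<beta>_def algebra_simps power2_eq_square)
qed

lemma \<alpha>_recursion: "p + (1 - p) * (p * \<beta>) ^ 3 \<le> p * \<beta>"
proof -
  have "p * (1 + x * \<beta> ^ 3) \<le> p * \<beta>" using \<beta>_recursion p by (intro mult_left_mono) auto
  then show ?thesis by (simp add: x_def algebra_simps power2_eq_square power3_eq_cube)
qed

text \<open>The largest value of \<open>c\<close> that \<open>(t + 2) p\<^sup>2 \<le> 1 + p\<close> allows.\<close>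

definition "C = (1 - p)\<^sup>2 * (1 + 2 * p)"

lemma C_eq: "C = 1 - 3 * p\<^sup>2 + 2 * p ^ 3"
  by (simp add: C_def power2_eq_square power3_eq_cube algebra_simps)

lemma c_le_C: "c \<le> C" using c_le by (simp add: C_def)

lemma C_le_1: "C \<le> 1"
proof -
  have "0 \<le> p\<^sup>2 * (3 - 2 * p)" using p_le by (intro mult_nonneg_nonneg) auto
  then show ?thesis by (simp add: C_eq power2_eq_square power3_eq_cube algebra_simps)
qed

text \<open>The next three estimates are the bounds, in units of \<open>p ^ t\<close>, for families whose members have at
most one hole in \<open>{1..t}\<close>, at most two holes, and for families with a member that has at least three.\<close>

lemma estimate_one_hole: "p + c * (\<beta> ^ 3 - 1 + p) < 1"
proof -
  have "c * (\<beta> ^ 3 - 1 + p) \<le> c * (4 * x + p)"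
    using \<beta>_cube_le c_pos by (intro mult_left_mono) auto
  also have "\<dots> \<le> 1 * (4 * x + p)"
    using c_le_C C_le_1 x_pos p by (intro mult_right_mono) auto
  finally show ?thesis using x_bound p_bound by simp
qed

lemma estimate_two_holes: "p\<^sup>2 + c * (\<beta> ^ 3 - 1 + p) + c\<^sup>2 / 2 * \<beta> ^ 6 < 1"
proof -
  define Q where "Q = (1 - p) * (3 - 2 * p)"
  define e where "e = p\<^sup>2 * (1 - 2 * p - 4 * (p\<^sup>2 * Q))"
  define b where "b = 1 + 4 * x"
  have b: "\<beta> ^ 3 \<le> b" "0 \<le> b" using \<beta>_cube_le x_pos by (auto simp: b_def)
  have "(\<beta> ^ 3) ^ 2 \<le> b ^ 2" using b \<beta>_pos by (intro power_mono) auto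
  then have b6: "\<beta> ^ 6 \<le> b\<^sup>2" by (simp flip: power_mult)
  have p2: "0 \<le> p\<^sup>2" "p\<^sup>2 \<le> 0.075"
  proof -
    have "p\<^sup>2 \<le> 0.2738\<^sup>2" using p p_bound by (intro power_mono) auto
    then show "p\<^sup>2 \<le> 0.075" by (simp add: power2_eq_square)
  qed simp
  have e: "- (p\<^sup>2) \<le> e" "e \<le> p\<^sup>2"
  proof -
    have "0 \<le> Q" unfolding Q_def using p_le by (intro mult_nonneg_nonneg) auto
    moreover have "Q \<le> 1 * 3" unfolding Q_def using p_le by (intro mult_mono) auto
    ultimately have 1: "0 \<le> p\<^sup>2 * Q" "p\<^sup>2 * Q \<le> 0.075 * 3" using p2 mult_mono[of "p\<^sup>2" "0.075" Q 3] by auto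
    define R where "R = p\<^sup>2 * Q"
    have "0 \<le> R" "R \<le> 0.225" using 1 by (simp_all add: R_def)
    then have "- 1 \<le> 1 - 2 * p - 4 * R" "1 - 2 * p - 4 * R \<le> 1"
      using p p_bound by simp_all
    then have bounds: "- 1 \<le> 1 - 2 * p - 4 * (p\<^sup>2 * Q)" "1 - 2 * p - 4 * (p\<^sup>2 * Q) \<le> 1"
      by (simp_all only: R_def)
    have "p\<^sup>2 * (- 1) \<le> e" "e \<le> p\<^sup>2 * 1"
      unfolding e_def by (rule mult_left_mono[OF bounds(1)] mult_left_mono[OF bounds(2)]; simp)+
    then show "- (p\<^sup>2) \<le> e" "e \<le> p\<^sup>2" by simp_all
  qed
  have "\<bar>e\<bar> \<le> p\<^sup>2" using e by auto
  then have e2: "e\<^sup>2 \<le> (p\<^sup>2)\<^sup>2" by (rule abs_le_square_iff[THEN iffD1, OF order_trans]) simp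
  \<comment> \<open>The reason for the choice of \<open>e\<close>: \<open>C * b\<close>, which bounds \<open>c * \<beta> ^ 3\<close>, is so close to 1 that its square need only be expanded at 1.\<close>
  have "C * b = 1 + e"
    unfolding C_eq b_def x_def e_def Q_def
    by (simp add: power2_eq_square power3_eq_cube algebra_simps)
  have "c * b \<le> C * b" using c_le_C b by (intro mult_right_mono) auto
  then have cb: "c * b \<le> 1 + e" "0 \<le> c * b" using \<open>C * b = 1 + e\<close> c_pos b by auto
  have "p\<^sup>2 + c * (\<beta> ^ 3 - 1 + p) + c\<^sup>2 / 2 * \<beta> ^ 6 \<le> p\<^sup>2 + c * (b - 1 + p) + c\<^sup>2 / 2 * b\<^sup>2"
    using b6 b c_pos by (intro add_mono mult_left_mono) auto
  also have "\<dots> = p\<^sup>2 + c * (b - 1 + p) + (c * b)\<^sup>2 / 2" by (simp add: power_mult_distrib)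
  also have "c * (b - 1 + p) \<le> C * (b - 1 + p)"
    using c_le_C x_pos p by (intro mult_right_mono) (auto simp: b_def)
  also have "\<dots> = 1 + e - C * (1 - p)" using \<open>C * b = 1 + e\<close> by (simp add: algebra_simps)
  also have "(c * b)\<^sup>2 \<le> (1 + e)\<^sup>2" using cb by (intro power_mono) auto
  also have "(1 + e)\<^sup>2 / 2 = 1/2 + e + e\<^sup>2 / 2" by (simp add: power2_eq_square algebra_simps add_divide_distrib)
  also have "\<dots> \<le> 1/2 + e + (p\<^sup>2)\<^sup>2 / 2" using e2 by simp
  finally have "p\<^sup>2 + c * (\<beta> ^ 3 - 1 + p) + c\<^sup>2 / 2 * \<beta> ^ 6
    \<le> p\<^sup>2 + (1 + e - C * (1 - p)) + (1/2 + e + (p\<^sup>2)\<^sup>2 / 2)" by simp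
  also have "\<dots> = 1/2 + p + p * (p * (6 - 9 * p - 43/2 * p\<^sup>2 + 40 * p ^ 3 - 16 * p ^ 4))"
    unfolding C_eq e_def Q_def by (simp add: power2_eq_square power3_eq_cube power4_eq_xxxx field_simps)
  also have "p * (p * (6 - 9 * p - 43/2 * p\<^sup>2 + 40 * p ^ 3 - 16 * p ^ 4)) \<le> p * 0.82"
  proof (intro mult_left_mono)
    have "p\<^sup>2 * (40 * p) \<le> p\<^sup>2 * 11" using p_bound by (intro mult_left_mono) auto
    then have 1: "40 * p ^ 3 \<le> 11 * p\<^sup>2" by (simp add: power2_eq_square power3_eq_cube)
    have "p * (6 - 9 * p - 43/2 * p\<^sup>2 + 40 * p ^ 3 - 16 * p ^ 4) \<le> p * (6 - 9 * p - 21/2 * p\<^sup>2)"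
    proof (rule mult_left_mono)
      have "0 \<le> p ^ 4" by simp
      with 1 show "6 - 9 * p - 43/2 * p\<^sup>2 + 40 * p ^ 3 - 16 * p ^ 4 \<le> 6 - 9 * p - 21/2 * p\<^sup>2"
        by linarith
    qed (use p in simp)
    also have "\<dots> \<le> 0.82"
    proof -
      \<comment> \<open>Tangents of \<open>p ^ 3\<close> and \<open>p\<^sup>2\<close> close to the maximum of the cubic polynomial to be bounded.\<close>
      have "0 \<le> (p - 1/4)\<^sup>2 * (p + 1/2)" using p by simp
      moreover have "0 \<le> (p - 0.224)\<^sup>2" by simp
      ultimately show ?thesis using p by (simp add: power2_eq_square algebra_simps add_divide_distrib)
    qed
    finally show "p * (6 - 9 * p - 43/2 * p\<^sup>2 + 40 * p ^ 3 - 16 * p ^ 4) \<le> 0.82" .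
  qed (use p in auto)
  also have "1/2 + p + p * 0.82 < 1" using p_bound by simp
  finally show ?thesis by simp
qed

lemma \<beta>_power_le: "\<beta> ^ t \<le> exp (c * (1 + 3.5 * x))"
proof -
  define y where "y = x + 3.5 * x\<^sup>2"
  have "x\<^sup>2 \<le> y\<^sup>2" using x_pos by (intro power_mono) (auto simp: y_def)
  then have "\<beta> \<le> 1 + y + y\<^sup>2 / 2" by (simp add: \<beta>_def y_def)
  also have "\<dots> \<le> exp y" using x_pos by (intro exp_lower_Taylor_quadratic) (simp add: y_def)
  finally have "\<beta> ^ t \<le> exp y ^ t" using \<beta>_pos by (intro power_mono) auto
  also have "\<dots> = exp (real t * y)" by (simp add: exp_of_nat_mult)
  also have "real t * y = c * (1 + 3.5 * x)" by (simp add: c_def y_def algebra_simps power2_eq_square)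
  finally show ?thesis .
qed

lemma exp_increment: "0 \<le> b \<Longrightarrow> b \<le> a \<Longrightarrow> a - b \<le> exp a - exp b" for a b :: real
proof -
  assume ab: "0 \<le> b" "b \<le> a"
  have "exp a = exp b * exp (a - b)" by (simp flip: exp_add)
  also have "\<dots> \<ge> exp b * (1 + (a - b))" using exp_ge_add_one_self by (intro mult_left_mono) auto
  moreover have "1 * (a - b) \<le> exp b * (a - b)" using ab by (intro mult_right_mono) auto
  ultimately show ?thesis by (simp add: algebra_simps)
qed

text \<open>For \<open>p = p0 t\<close> and \<open>t\<close> tending to infinity, \<open>\<beta> ^ t\<close> tends to \<open>exp 1\<close> and \<open>c\<close> to 1, so the left-hand side tends to \<open>exp 1 - 2\<close>.
It has to be kept below 1 for \<open>p\<close> up to \<open>p0 15\<close>. The left-hand side grows with \<open>c\<close>, so \<open>c\<close> may be replaced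
by \<open>C\<close>; the claim then becomes a polynomial inequality in \<open>p\<close>, by writing \<open>exp (C * k)\<close> as
\<open>exp 1 / exp (1 - C * k)\<close> and bounding the denominator linearly.\<close>

lemma estimate_many_holes: "\<beta> ^ t - 1 - c + (1 + c) * p\<^sup>2 < 1"
proof -
  define k where "k = 1 + 3.5 * x"
  define u where "u = p\<^sup>2"
  define m where "m = - 0.5 + 1.5 * p + 5.7 * u"
  define B where "B = 3 - 5 * u + 2 * p * u"
  have u: "0 \<le> u" "u \<le> 0.075"
  proof -
    have "p\<^sup>2 \<le> 0.2738\<^sup>2" using p p_bound by (intro power_mono) auto
    then show "u \<le> 0.075" by (simp add: u_def power2_eq_square)
  qed (simp add: u_def)
  have k: "1 \<le> k" using x_pos by (simp add: k_def)
  have p2: "p\<^sup>2 \<le> 1" using u by (simp add: u_def)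
  have "C - c \<le> k * (C - c)" using k c_le_C mult_right_mono[of 1 k "C - c"] by simp
  also have "\<dots> = C * k - c * k" by (simp add: algebra_simps)
  also have "\<dots> \<le> exp (C * k) - exp (c * k)"
    using k c_pos c_le_C by (intro exp_increment mult_right_mono mult_nonneg_nonneg) auto
  finally have inc: "exp (c * k) - c \<le> exp (C * k) - C" by simp
  have cC: "c * p\<^sup>2 \<le> C * p\<^sup>2" using c_le_C by (intro mult_right_mono) auto
  have "1 - C * k = u * (- 0.5 + 1.5 * p + u * (10.5 - 17.5 * p + 7 * u))"
    unfolding C_eq k_def x_def u_def
    by (simp add: power2_eq_square power3_eq_cube field_simps)
  also have "\<dots> \<ge> u * m"
  proof (intro mult_left_mono)
    have "u * 5.7 \<le> u * (10.5 - 17.5 * p + 7 * u)" using u p_bound by (intro mult_left_mono) auto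
    then show "m \<le> - 0.5 + 1.5 * p + u * (10.5 - 17.5 * p + 7 * u)" by (simp add: m_def)
  qed (use u in auto)
  finally have \<delta>: "u * m \<le> 1 - C * k" .
  have "- 0.5 \<le> m" using p u by (simp add: m_def)
  then have "u * (- 0.5) \<le> u * m" using u by (intro mult_left_mono) auto
  then have um: "0 < 1 + u * m" using u by simp
  have "exp (C * k) * (1 + u * m) \<le> exp (C * k) * exp (1 - C * k)"
    using \<delta> exp_ge_add_one_self[of "1 - C * k"] by (intro mult_left_mono) auto
  also have "\<dots> = exp 1" by (simp flip: exp_add)
  also have "\<dots> < 2.72" using e_less_272 by simp
  also have "2.72 < B * (1 + u * m)"
  proof -
    have B: "2.6 \<le> B" "B \<le> 3"
    proof -
      have "2 * p * u \<le> 1 * u" using p_bound u by (intro mult_right_mono) auto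
      then show "B \<le> 3" using u by (simp add: B_def)
      have "0 \<le> p * u" using p u by simp
      then show "2.6 \<le> B" using u by (simp add: B_def)
    qed
    have "5 * u - 2 * p * u - u * m * B < 0.28"
    proof (cases "m < 0")
      case True
      have "p \<le> 0.2"
      proof (rule ccontr)
        assume "\<not> p \<le> 0.2"
        then have "0.2\<^sup>2 \<le> p\<^sup>2" "0.2 \<le> p" by (auto intro: power_mono)
        then show False using True by (simp add: m_def u_def power2_eq_square)
      qed
      then have "p\<^sup>2 \<le> 0.2\<^sup>2" using p by (intro power_mono) auto
      then have u': "u \<le> 0.04" by (simp add: u_def power2_eq_square)
      have "(- m) * B \<le> 0.5 * 3" using True \<open>- 0.5 \<le> m\<close> B by (intro mult_mono) auto
      then have "u * ((- m) * B) \<le> u * (0.5 * 3)" using u by (intro mult_left_mono) auto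
      moreover have "0 \<le> p * u" using p u by simp
      ultimately show ?thesis using u' by (simp add: mult.assoc)
    next
      case False
      have "m * 2.6 \<le> m * B" using False B by (intro mult_left_mono) auto
      then have "u * (m * 2.6) \<le> u * (m * B)" using u(1) by (rule mult_left_mono)
      then have "5 * u - 2 * p * u - u * m * B \<le> p * (p * (5 - 2 * p - 2.6 * m))"
        by (simp add: u_def power2_eq_square algebra_simps)
      also have "\<dots> \<le> p * 1.02"
      proof (intro mult_left_mono)
        \<comment> \<open>Tangents of \<open>p ^ 3\<close> and \<open>p\<^sup>2\<close> close to the maximum of the cubic polynomial to be bounded.\<close>
        have "0 \<le> (p - 0.26)\<^sup>2 * (p + 0.52)" using p by simp
        then have "0.2028 * p - 0.035152 \<le> p ^ 3"
          by (simp add: power2_eq_square power3_eq_cube algebra_simps add_divide_distrib)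
        moreover have "0 \<le> (p - 0.27)\<^sup>2" by simp
        then have "0.54 * p - 0.0729 \<le> p\<^sup>2" by (simp add: power2_eq_square algebra_simps)
        moreover have "p * (5 - 2 * p - 2.6 * m) = 6.3 * p - 5.9 * p\<^sup>2 - 14.82 * p ^ 3"
          by (simp add: m_def u_def power2_eq_square power3_eq_cube algebra_simps)
        ultimately show "p * (5 - 2 * p - 2.6 * m) \<le> 1.02" using p_bound by simp
      qed (use p in auto)
      also have "\<dots> < 0.28" using p_bound by simp
      finally show ?thesis .
    qed
    moreover have "B * (1 + u * m) = 3 - (5 * u - 2 * p * u - u * m * B)"
      by (simp add: B_def algebra_simps)
    ultimately show ?thesis by simp
  qed
  finally have "exp (C * k) < B" using um by simp
  moreover have "B \<le> 2 + C - (1 + C) * p\<^sup>2"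
  proof -
    have "0 \<le> p ^ 4 * (3 - 2 * p)" using p_le by (intro mult_nonneg_nonneg) auto
    then show ?thesis
      by (simp add: B_def C_eq u_def power2_eq_square power3_eq_cube power4_eq_xxxx algebra_simps)
  qed
  moreover have "\<beta> ^ t \<le> exp (c * k)" using \<beta>_power_le by (simp add: k_def)
  ultimately show ?thesis using inc cC by (simp add: distrib_right)
qed

end

section \<open>Shifted families other than the Frankl families\<close>

context small_bias
begin

lemma mu_le_link_bounds:
  assumes "G \<subseteq> Pow {1..n}" "t \<le> n"
    and "\<And>S. S \<subseteq> {1..t} \<Longrightarrow> mu p {t<..n} (link t n S G) \<le> g (card ({1..t} - S))"
  shows "mu p {1..n} G \<le> (\<Sum>i\<le>t. real (t choose i) * (p ^ (t - i) * (1 - p) ^ i * g i))"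
proof -
  have V: "{1..t} \<union> {t<..n} = {1..n}" "{1..t} \<inter> {t<..n} = {}" using assms(2) by auto
  have "mu p {1..n} G = (\<Sum>S\<in>Pow {1..t}. p ^ card S * (1 - p) ^ (t - card S) * mu p {t<..n} (link t n S G))"
    using mu_split[of "{1..t}" "{t<..n}" G p] V assms(1) by (simp add: link_def)
  also have "\<dots> \<le> (\<Sum>S\<in>Pow {1..t}. p ^ (t - (t - card S)) * (1 - p) ^ (t - card S) * g (t - card S))"
  proof (rule sum_mono)
    fix S assume S: "S \<in> Pow {1..t}"
    then have fin: "finite S" using finite_subset[of S "{1..t}"] by simp
    have "card S \<le> t" using card_mono[of "{1..t}" S] S by simp
    moreover have "card ({1..t} - S) = t - card S" using S fin by (simp add: card_Diff_subset)
    ultimately show "p ^ card S * (1 - p) ^ (t - card S) * mu p {t<..n} (link t n S G)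
        \<le> p ^ (t - (t - card S)) * (1 - p) ^ (t - card S) * g (t - card S)"
      using assms(3)[of S] S p_le by (intro mult_mono) (auto simp: mu_nonneg)
  qed
  also have "\<dots> = (\<Sum>i\<le>t. real (t choose i) * (p ^ (t - i) * (1 - p) ^ i * g i))"
    using sum_Pow_card_Diff[of "{1..t}" "\<lambda>i. p ^ (t - i) * (1 - p) ^ i * g i"] by simp
  finally show ?thesis .
qed

lemma p_power: "p ^ t = p ^ (t - 1) * p" "p ^ t = p ^ (t - 2) * p\<^sup>2"
proof -
  have "t = (t - 1) + 1" "t = (t - 2) + 2" using t by simp_all
  then have "p ^ t = p ^ ((t - 1) + 1)" "p ^ t = p ^ ((t - 2) + 2)" by simp_all
  then show "p ^ t = p ^ (t - 1) * p" "p ^ t = p ^ (t - 2) * p\<^sup>2" by (simp_all only: power_add power_one_right)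
qed

lemma one_hole_weight: "real t * (p ^ (t - 1) * (1 - p) * (p ^ 3 * z)) = p ^ t * (c * z)"
  unfolding p_power(1) by (simp add: c_def x_def power2_eq_square power3_eq_cube)

lemma link_sum_two_holes:
  assumes "\<And>i. 2 < i \<Longrightarrow> g i = 0"
  shows "(\<Sum>i\<le>t. real (t choose i) * (p ^ (t - i) * (1 - p) ^ i * g i))
    = p ^ t * g 0 + real t * (p ^ (t - 1) * (1 - p) * g 1) + real (t choose 2) * (p ^ (t - 2) * (1 - p)\<^sup>2 * g 2)"
proof -
  have "(\<Sum>i\<le>t. real (t choose i) * (p ^ (t - i) * (1 - p) ^ i * g i))
    = (\<Sum>i\<in>{0,1,2}. real (t choose i) * (p ^ (t - i) * (1 - p) ^ i * g i))"
    using t assms by (intro sum.mono_neutral_right) auto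
  then show ?thesis by simp
qed

lemma choose_2_weight: "real (t choose 2) * (p ^ (t - 2) * (1 - p)\<^sup>2 * (p * \<beta>) ^ 6) \<le> p ^ t * (c\<^sup>2 / 2 * \<beta> ^ 6)"
proof -
  have "t choose 2 = t * (t - 1) div 2" by (rule choose_two)
  then have "real (t choose 2) \<le> real (t * (t - 1)) / 2"
    using of_nat_div_le_of_nat[of "t * (t - 1)" 2, where ?'a = real] by simp
  also have "\<dots> \<le> (real t)\<^sup>2 / 2" by (simp add: power2_eq_square mult_left_mono)
  finally have "real (t choose 2) * (p ^ (t - 2) * (1 - p)\<^sup>2 * (p * \<beta>) ^ 6)
    \<le> (real t)\<^sup>2 / 2 * (p ^ (t - 2) * (1 - p)\<^sup>2 * (p * \<beta>) ^ 6)"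
    using p \<beta>_pos by (intro mult_right_mono) auto
  also have "\<dots> = p ^ t * (c\<^sup>2 / 2 * \<beta> ^ 6)"
  proof -
    have "p ^ 6 = p\<^sup>2 * (p\<^sup>2 * p\<^sup>2)" by (simp flip: power_add)
    then show ?thesis unfolding p_power(2) c_def x_def power_mult_distrib by (simp add: power2_eq_square)
  qed
  finally show ?thesis .
qed

text \<open>Without the corrections for \<open>i = 0\<close> and \<open>i = 1\<close> the terms add up to \<open>(p + (1 - p) * \<alpha> ^ 3) ^ t\<close>, by the
binomial theorem, and this is at most \<open>\<alpha> ^ t\<close> for \<open>\<alpha> = p * \<beta>\<close>.\<close>

lemma link_sum_many_holes:
  assumes "g 0 = y" "g 1 = (p * \<beta>) ^ 3 - p ^ 3 + p ^ 3 * y" "\<And>i. 1 < i \<Longrightarrow> g i = ((p * \<beta>) ^ 3) ^ i"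
  shows "(\<Sum>i\<le>t. real (t choose i) * (p ^ (t - i) * (1 - p) ^ i * g i))
    \<le> p ^ t * (\<beta> ^ t - 1 - c + (1 + c) * y)"
proof -
  define \<alpha> where "\<alpha> = p * \<beta>"
  have g: "g i = (\<alpha> ^ 3) ^ i + (if i = 0 then y - 1 else 0) + (if i = 1 then p ^ 3 * (y - 1) else 0)" for i
    using assms by (cases "i = 0"; cases "i = 1") (auto simp: \<alpha>_def algebra_simps)
  have "(\<Sum>i\<le>t. real (t choose i) * (p ^ (t - i) * (1 - p) ^ i * g i))
    = (\<Sum>i\<le>t. real (t choose i) * ((1 - p) * \<alpha> ^ 3) ^ i * p ^ (t - i))
      + (\<Sum>i\<le>t. if i = 0 then p ^ t * (y - 1) else 0)
      + (\<Sum>i\<le>t. if i = 1 then real t * (p ^ (t - 1) * (1 - p) * (p ^ 3 * (y - 1))) else 0)"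
    unfolding sum.distrib[symmetric] g
  proof (intro sum.cong refl)
    fix i :: nat
    consider "i = 0" | "i = 1" | "i \<noteq> 0" "i \<noteq> 1" by auto
    then show "real (t choose i) * (p ^ (t - i) * (1 - p) ^ i *
        ((\<alpha> ^ 3) ^ i + (if i = 0 then y - 1 else 0) + (if i = 1 then p ^ 3 * (y - 1) else 0)))
      = real (t choose i) * ((1 - p) * \<alpha> ^ 3) ^ i * p ^ (t - i) + (if i = 0 then p ^ t * (y - 1) else 0)
        + (if i = 1 then real t * (p ^ (t - 1) * (1 - p) * (p ^ 3 * (y - 1))) else 0)"
    proof cases
      case 3
      then show ?thesis by (simp add: power_mult_distrib mult_ac)
    qed (simp_all add: algebra_simps)
  qed
  also have "(\<Sum>i\<le>t. real (t choose i) * ((1 - p) * \<alpha> ^ 3) ^ i * p ^ (t - i)) = ((1 - p) * \<alpha> ^ 3 + p) ^ t"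
    by (simp add: binomial_ring)
  also have "((1 - p) * \<alpha> ^ 3 + p) ^ t \<le> \<alpha> ^ t"
    using \<alpha>_recursion p_le \<beta>_pos by (intro power_mono) (auto simp: \<alpha>_def add.commute)
  also have "(\<Sum>i\<le>t. if i = 1 then real t * (p ^ (t - 1) * (1 - p) * (p ^ 3 * (y - 1))) else 0)
    = p ^ t * (c * (y - 1))"
    using t one_hole_weight[of "y - 1"] by simp
  also have "(\<Sum>i\<le>t. if i = 0 then p ^ t * (y - 1) else 0) = p ^ t * (y - 1)" by simp
  also have "\<alpha> ^ t + p ^ t * (y - 1) + p ^ t * (c * (y - 1)) = p ^ t * (\<beta> ^ t - 1 - c + (1 + c) * y)"
    by (simp add: \<alpha>_def power_mult_distrib algebra_simps)
  finally show ?thesis by simp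
qed

lemma link_sum_few_holes:
  assumes "g 0 = y" "g 1 = (p * \<beta>) ^ 3 - p ^ 3 + p ^ 3 * p" "g 2 = z" "\<And>i. 2 < i \<Longrightarrow> g i = 0"
  shows "(\<Sum>i\<le>t. real (t choose i) * (p ^ (t - i) * (1 - p) ^ i * g i))
    = p ^ t * (y + c * (\<beta> ^ 3 - 1 + p)) + real (t choose 2) * (p ^ (t - 2) * (1 - p)\<^sup>2 * z)"
proof -
  have g1: "g 1 = p ^ 3 * (\<beta> ^ 3 - 1 + p)" unfolding assms(2) by (simp add: power_mult_distrib algebra_simps)
  have "(\<Sum>i\<le>t. real (t choose i) * (p ^ (t - i) * (1 - p) ^ i * g i))
    = p ^ t * g 0 + real t * (p ^ (t - 1) * (1 - p) * g 1) + real (t choose 2) * (p ^ (t - 2) * (1 - p)\<^sup>2 * g 2)"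
    by (rule link_sum_two_holes) (rule assms(4))
  also have "\<dots> = p ^ t * (y + c * (\<beta> ^ 3 - 1 + p)) + real (t choose 2) * (p ^ (t - 2) * (1 - p)\<^sup>2 * z)"
    unfolding g1 one_hole_weight assms(1,3) by (simp only: distrib_left)
  finally show ?thesis .
qed

text \<open>With \<open>i\<close> holes in \<open>{1..t}\<close> the link is a three-wise \<open>3 * i\<close>-intersecting family, so that it has measure at
most \<open>((p * \<beta>) ^ 3) ^ i\<close>. Summed over all \<open>i\<close> this would give about \<open>exp 1 * p ^ t\<close>. Let \<open>m\<close> be the
largest number of holes in \<open>{1..t}\<close> of a member. The terms with \<open>i > m\<close> are absent, and the complement of
an \<open>m\<close>-element interval is a member, which makes the full link pairwise \<open>m\<close>-intersecting and so reduces the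
term \<open>i = 0\<close> to \<open>p\<close> or \<open>p\<^sup>2\<close> times \<open>p ^ t\<close>. A member outside the second Frankl family does the same, by a factor
\<open>p\<close>, to the part of the term \<open>i = 1\<close> whose members contain \<open>t + 1\<close>, \<open>t + 2\<close> and \<open>t + 3\<close>; three holes
improve this factor to \<open>p\<^sup>2\<close>.\<close>

lemma mu_shifted_less:
  assumes G: "G \<subseteq> Pow {1..n}" "up_closed {1..n} G" "shifted_above 0 G" "three_wise_intersecting t G"
    and n: "t \<le> n" and F0: "F0 \<in> G" "\<not> {1..t} \<subseteq> F0" and not_near: "\<not> G \<subseteq> near {1..n} {1..t + 3} 1"
  shows "mu p {1..n} G < p ^ t"
proof -
  define L where "L S = link t n S G" for S
  have F0n: "F0 \<subseteq> {1..n}" using F0 G(1) by auto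
  have n3: "t + 3 \<le> n"
    by (rule ground_set_large[OF G(2-4) F0(1) F0n F0(2)]) (use t n in auto)
  have L: "L S \<subseteq> Pow {t<..n}" for S by (auto simp: L_def link_def)
  have Lshift: "shifted_above t (L S)" if "S \<subseteq> {1..t}" for S
    unfolding L_def by (rule shifted_above_link[OF G(3)]) (use that in auto)
  have Lthree: "three_wise_intersecting (3 * card ({1..t} - S)) (L S)" if "S \<subseteq> {1..t}" for S
    using three_wise_link_prefix[OF G(3,4) that _ n] by (simp add: L_def)
  have \<alpha>: "0 \<le> p * \<beta>" "p + (1 - p) * (p * \<beta>) ^ 3 \<le> p * \<beta>"
    using \<alpha>_recursion p \<beta>_pos by auto
  have general: "mu p {t<..n} (L S) \<le> ((p * \<beta>) ^ 3) ^ card ({1..t} - S)" if "S \<subseteq> {1..t}" for S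
    using mu_shifted_le[OF L Lshift[OF that] Lthree[OF that] p_le(4,5) \<alpha>] by (simp add: power_mult)
  have holes: "{1..n} - {k - m<..k} \<in> G" if "F \<in> G" "k \<le> n" "m \<le> card ({1..k} - F)" for F k m
    using holes_at_top[OF G(2,3) that(1) _ that(2,3)] that(1) G(1) by auto
  have full1: "mu p {t<..n} (L {1..t}) \<le> p" if "{1..n} - K \<in> G" "K \<subseteq> {1..t}" "card K = 1" for K
    using link_full_intersecting[OF G(4) that(2,1) n] that(3) p p_le
    by (intro mu_intersecting L) (auto simp: L_def)
  have full2: "mu p {t<..n} (L {1..t}) \<le> p\<^sup>2" if "{1..n} - K \<in> G" "K \<subseteq> {1..t}" "2 \<le> card K" for K
    using link_full_intersecting[OF G(4) that(2,1) n] that(3) p p_le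
    by (intro mu_2_intersecting L) (auto simp: L_def intro: order_trans)
  have one: "mu p {t<..n} (L ({1..t} - {a})) \<le> (p * \<beta>) ^ 3 - p ^ 3 + p ^ 3 * M"
    if "a \<in> {1..t}" "mu p {t + 3<..n} (link (t + 3) n ({1..t + 3} - {a}) G) \<le> M" for a M
  proof (rule mu_three_wise_3_le[OF L Lshift _ n3 p_le(4,5) \<alpha>])
    have "{1..t} - ({1..t} - {a}) = {a}" using that(1) by auto
    then show "three_wise_intersecting 3 (L ({1..t} - {a}))" using Lthree[of "{1..t} - {a}"] by simp
    have "{1..t} - {a} \<union> {t + 1, t + 2, t + 3} = {1..t + 3} - {a}" using that(1) by auto
    then have "link (t + 3) n {t + 1, t + 2, t + 3} (L ({1..t} - {a})) = link (t + 3) n ({1..t + 3} - {a}) G"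
      unfolding L_def using n3 by (subst link_link) auto
    then show "mu p {t + 3<..n} (link (t + 3) n {t + 1, t + 2, t + 3} (L ({1..t} - {a}))) \<le> M"
      using that(2) by simp
  qed auto
  have sub3: "link (t + 3) n S G \<subseteq> Pow {t + 3<..n}" for S by (auto simp: link_def)
  have one1: "mu p {t<..n} (L ({1..t} - {a})) \<le> (p * \<beta>) ^ 3 - p ^ 3 + p ^ 3 * p" if a: "a \<in> {1..t}" for a
  proof (rule one[OF a])
    \<comment> \<open>The member \<open>F\<close> has two holes in \<open>{1..t + 3}\<close>, which are moved to \<open>t + 2\<close> and \<open>t + 3\<close>. This leaves \<open>t\<close> and \<open>t + 1\<close> for the single holes.\<close>
    obtain F where F: "F \<in> G" "F \<notin> near {1..n} {1..t + 3} 1" using not_near by auto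
    then have "2 \<le> card ({1..t + 3} - F)" using G(1) by (auto simp: near_def)
    then have K: "{1..n} - {t + 1<..t + 3} \<in> G" using holes[OF F(1) n3, of 2] by simp
    have "card {t + 1<..t + 3} \<le> card (X \<inter> Y) + 1"
      if "X \<in> link (t + 3) n ({1..t + 3} - {a}) G" "Y \<in> link (t + 3) n ({1..t + 3} - {a}) G" for X Y
      by (rule link_one_hole_intersecting[OF G(4,3) _ K n3 _ _ _ a that, of t "t + 1"]) auto
    then show "mu p {t + 3<..n} (link (t + 3) n ({1..t + 3} - {a}) G) \<le> p"
      using p p_le by (intro mu_intersecting sub3) auto
  qed
  show ?thesis
  proof (cases "\<exists>F\<in>G. 3 \<le> card ({1..t} - F)")
    case True
    then obtain F where F: "F \<in> G" "3 \<le> card ({1..t} - F)" by auto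
    have K: "{1..n} - {t - 3<..t} \<in> G" using holes[OF F(1) n F(2)] .
    \<comment> \<open>For the tails of the sets with one hole, the three holes are moved only to \<open>t - 1\<close>, \<open>t\<close>, \<open>t + 1\<close>, to leave \<open>t + 2\<close> and \<open>t + 3\<close> free.\<close>
    have "card ({1..t} - F) \<le> card ({1..t + 1} - F)" by (intro card_mono) auto
    then have K': "{1..n} - {t - 2<..t + 1} \<in> G"
      using holes[OF F(1), of "t + 1" 3] F(2) n3 by simp
    have one2: "mu p {t<..n} (L ({1..t} - {a})) \<le> (p * \<beta>) ^ 3 - p ^ 3 + p ^ 3 * p\<^sup>2" if a: "a \<in> {1..t}" for a
    proof (rule one[OF a])
      have "card {t - 2<..t + 1} \<le> card (X \<inter> Y) + 1"
        if "X \<in> link (t + 3) n ({1..t + 3} - {a}) G" "Y \<in> link (t + 3) n ({1..t + 3} - {a}) G" for X Y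
        by (rule link_one_hole_intersecting[OF G(4,3) _ K' n3 _ _ _ a that, of "t + 2" "t + 3"]) auto
      then show "mu p {t + 3<..n} (link (t + 3) n ({1..t + 3} - {a}) G) \<le> p\<^sup>2"
        using p p_le t by (intro mu_2_intersecting sub3) auto
    qed
    define g where "g i = (if i = 0 then p\<^sup>2 else if i = 1 then (p * \<beta>) ^ 3 - p ^ 3 + p ^ 3 * p\<^sup>2
      else ((p * \<beta>) ^ 3) ^ i)" for i :: nat
    have "mu p {t<..n} (link t n S G) \<le> g (card ({1..t} - S))" if S: "S \<subseteq> {1..t}" for S
    proof -
      consider "S = {1..t}" | a where "a \<in> {1..t}" "S = {1..t} - {a}" | "1 < card ({1..t} - S)"
      proof -
        have "S = {1..t}" if "card ({1..t} - S) = 0" using that S by auto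
        moreover have "\<exists>a\<in>{1..t}. S = {1..t} - {a}" if "card ({1..t} - S) = 1"
          using that S by (auto simp: card_1_singleton_iff)
        ultimately show ?thesis using that by (metis less_one linorder_neqE_nat)
      qed
      then show ?thesis
      proof cases
        case 1
        have "{t - 3<..t} \<subseteq> {1..t}" by auto
        with full2[OF K] t show ?thesis unfolding 1 by (simp add: g_def L_def)
      next
        case (2 a)
        moreover from this have "{1..t} - S = {a}" by auto
        ultimately show ?thesis using one2[of a] by (simp add: g_def L_def)
      next
        case 3
        then have "card ({1..t} - S) \<noteq> 0" "card ({1..t} - S) \<noteq> 1" by linarith+
        then have "g (card ({1..t} - S)) = ((p * \<beta>) ^ 3) ^ card ({1..t} - S)"
          by (simp only: g_def if_False)
        then show ?thesis using general[OF S] by (simp only: L_def)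
      qed
    qed
    then have "mu p {1..n} G \<le> (\<Sum>i\<le>t. real (t choose i) * (p ^ (t - i) * (1 - p) ^ i * g i))"
      by (rule mu_le_link_bounds[OF G(1) n])
    also have "\<dots> \<le> p ^ t * (\<beta> ^ t - 1 - c + (1 + c) * p\<^sup>2)"
      by (rule link_sum_many_holes) (auto simp: g_def)
    also have "\<dots> < p ^ t * 1" using estimate_many_holes p by (intro mult_strict_left_mono) auto
    finally show ?thesis by simp
  next
    case no3: False
    have empty: "L S = {}" if "S \<subseteq> {1..t}" "\<And>F. F \<in> G \<Longrightarrow> card ({1..t} - F) < card ({1..t} - S)" for S
    proof (rule ccontr)
      assume "L S \<noteq> {}"
      then obtain X where X: "X \<subseteq> {t<..n}" "S \<union> X \<in> G" by (auto simp: L_def link_def)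
      have "{1..t} - (S \<union> X) = {1..t} - S" using X(1) by auto
      with that(2)[OF X(2)] show False by simp
    qed
    have cases_S: "S = {1..t} \<or> (\<exists>a\<in>{1..t}. S = {1..t} - {a}) \<or> card ({1..t} - S) = 2 \<or> 2 < card ({1..t} - S)"
      if "S \<subseteq> {1..t}" for S
    proof -
      have "S = {1..t}" if "card ({1..t} - S) = 0" using that \<open>S \<subseteq> {1..t}\<close> by auto
      moreover have "\<exists>a\<in>{1..t}. S = {1..t} - {a}" if "card ({1..t} - S) = 1"
        using that \<open>S \<subseteq> {1..t}\<close> by (auto simp: card_1_singleton_iff)
      ultimately show ?thesis by linarith
    qed
    have bound: "mu p {1..n} G \<le> p ^ t * (y + c * (\<beta> ^ 3 - 1 + p)) + real (t choose 2) * (p ^ (t - 2) * (1 - p)\<^sup>2 * z)"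
      if y: "mu p {t<..n} (L {1..t}) \<le> y"
        and z: "\<And>S. S \<subseteq> {1..t} \<Longrightarrow> card ({1..t} - S) = 2 \<Longrightarrow> mu p {t<..n} (L S) \<le> z" for y z
    proof -
      define g where "g i = (if i = 0 then y else if i = 1 then (p * \<beta>) ^ 3 - p ^ 3 + p ^ 3 * p
        else if i = 2 then z else 0)" for i :: nat
      have "mu p {t<..n} (link t n S G) \<le> g (card ({1..t} - S))" if S: "S \<subseteq> {1..t}" for S
      proof -
        consider "S = {1..t}" | a where "a \<in> {1..t}" "S = {1..t} - {a}"
          | "card ({1..t} - S) = 2" | "2 < card ({1..t} - S)" using cases_S[OF S] by auto
        then show ?thesis
        proof cases
          case 1
          then show ?thesis using y by (simp add: g_def L_def)
        next
          case (2 a)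
          moreover from this have "{1..t} - S = {a}" by auto
          ultimately show ?thesis using one1[of a] by (simp add: g_def L_def)
        next
          case 3
          then show ?thesis using z[OF S] by (simp add: g_def L_def)
        next
          case 4
          then have "L S = {}" using S no3 by (intro empty) force+
          moreover have "card ({1..t} - S) \<noteq> 0" "card ({1..t} - S) \<noteq> 1" "card ({1..t} - S) \<noteq> 2"
            using 4 by linarith+
          then have "g (card ({1..t} - S)) = 0" by (simp only: g_def if_False)
          ultimately show ?thesis by (simp add: L_def mu_def)
        qed
      qed
      then have "mu p {1..n} G \<le> (\<Sum>i\<le>t. real (t choose i) * (p ^ (t - i) * (1 - p) ^ i * g i))"
        by (rule mu_le_link_bounds[OF G(1) n])
      also have "\<dots> = p ^ t * (y + c * (\<beta> ^ 3 - 1 + p)) + real (t choose 2) * (p ^ (t - 2) * (1 - p)\<^sup>2 * z)"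
        by (rule link_sum_few_holes) (auto simp: g_def)
      finally show ?thesis .
    qed
    show ?thesis
    proof (cases "\<exists>F\<in>G. 2 \<le> card ({1..t} - F)")
      case True
      then obtain F where F: "F \<in> G" "2 \<le> card ({1..t} - F)" by auto
      have K: "{1..n} - {t - 2<..t} \<in> G" using holes[OF F(1) n F(2)] .
      have "mu p {1..n} G \<le> p ^ t * (p\<^sup>2 + c * (\<beta> ^ 3 - 1 + p))
          + real (t choose 2) * (p ^ (t - 2) * (1 - p)\<^sup>2 * (p * \<beta>) ^ 6)"
      proof (rule bound)
        have "{t - 2<..t} \<subseteq> {1..t}" by auto
        with full2[OF K] t show "mu p {t<..n} (L {1..t}) \<le> p\<^sup>2" by simp
        show "mu p {t<..n} (L S) \<le> (p * \<beta>) ^ 6" if "S \<subseteq> {1..t}" "card ({1..t} - S) = 2" for S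
          using general[OF that(1)] that(2) by (simp flip: power_mult)
      qed
      also have "\<dots> \<le> p ^ t * (p\<^sup>2 + c * (\<beta> ^ 3 - 1 + p)) + p ^ t * (c\<^sup>2 / 2 * \<beta> ^ 6)"
        using choose_2_weight by simp
      also have "\<dots> = p ^ t * (p\<^sup>2 + c * (\<beta> ^ 3 - 1 + p) + c\<^sup>2 / 2 * \<beta> ^ 6)" by (simp add: algebra_simps)
      also have "\<dots> < p ^ t * 1" using estimate_two_holes p by (intro mult_strict_left_mono) auto
      finally show ?thesis by simp
    next
      case no2: False
      have "{1..t} - F0 \<noteq> {}" using F0(2) by auto
      then have "1 \<le> card ({1..t} - F0)" by (simp add: Suc_le_eq card_gt_0_iff)
      then have K: "{1..n} - {t - 1<..t} \<in> G" using holes[OF F0(1) n] by simp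
      have "mu p {1..n} G \<le> p ^ t * (p + c * (\<beta> ^ 3 - 1 + p))
          + real (t choose 2) * (p ^ (t - 2) * (1 - p)\<^sup>2 * 0)"
      proof (rule bound)
        have "{t - 1<..t} \<subseteq> {1..t}" by auto
        with full1[OF K] t show "mu p {t<..n} (L {1..t}) \<le> p" by simp
        show "mu p {t<..n} (L S) \<le> 0" if "S \<subseteq> {1..t}" "card ({1..t} - S) = 2" for S
        proof -
          have "L S = {}" using that no2 by (intro empty) force+
          then show ?thesis by (simp add: mu_def)
        qed
      qed
      also have "\<dots> = p ^ t * (p + c * (\<beta> ^ 3 - 1 + p))" by simp
      also have "\<dots> < p ^ t * 1" using estimate_one_hole p by (intro mult_strict_left_mono) auto
      finally show ?thesis by simp
    qed
  qed
qed

end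

section \<open>The theorem\<close>

definition extremal :: "nat \<Rightarrow> nat \<Rightarrow> real \<Rightarrow> nat set set \<Rightarrow> bool" where
  "extremal n t p G \<longleftrightarrow> (\<exists>s U. (s = 0 \<or> s = 1 \<and> p = p0 t) \<and> U \<subseteq> {1..n} \<and> card U = t + 3 * s \<and>
     G = near {1..n} U s)"

text \<open>The last factor exhibits \<open>(t + 2) p\<^sup>2 \<le> 1 + p\<close> as the condition for measure at most \<open>p ^ t\<close>.\<close>

lemma mu_near_1_eq:
  assumes "finite V" "U \<subseteq> V" "card U = t + 3"
  shows "mu p V (near V U 1) = p ^ t * (1 - (1 - p) * (1 + p - (real t + 2) * p\<^sup>2))"
proof -
  have e: "p ^ (t + 3 - 1) = p ^ t * p\<^sup>2" "p ^ (t + 3) = p ^ t * (p * p\<^sup>2)"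
    by (simp_all add: power_add power2_eq_square power3_eq_cube)
  show ?thesis
    using mu_near_1[OF assms(1,2), of p] unfolding assms(3) e
    by (simp add: algebra_simps power2_eq_square)
qed

lemma mu_extremal:
  assumes "extremal n t p G" "1 \<le> t"
  shows "mu p {1..n} G = p ^ t"
proof -
  obtain s U where s: "s = 0 \<or> s = 1 \<and> p = p0 t" and U: "U \<subseteq> {1..n}" "card U = t + 3 * s"
    and G: "G = near {1..n} U s" using assms(1) unfolding extremal_def by auto
  from s show ?thesis
  proof
    assume "s = 0"
    then show ?thesis using U G by (simp add: mu_near_0)
  next
    assume "s = 1 \<and> p = p0 t"
    then show ?thesis using U G mu_near_1_eq[of "{1..n}" U t p] p0_equation[OF assms(2)] by simp
  qed
qed

context
  fixes n t :: nat and p :: real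
  assumes t: "15 \<le> t" "t \<le> n" and p: "0 < p" "p \<le> p0 t"
begin

lemma small_bias: "small_bias t p"
  using t p p0_characterization(1)[of t p] by unfold_locales auto

lemma p_less_1: "p < 1"
  using small_bias.p_le(3)[OF small_bias] .

lemma mu_le_of_subset:
  assumes "G \<subseteq> H" "H \<subseteq> Pow {1..n}" "mu p {1..n} H \<le> p ^ t"
  shows "mu p {1..n} G \<le> p ^ t \<and> (mu p {1..n} G = p ^ t \<longrightarrow> G = H)"
proof (cases "G = H")
  case False
  then have "mu p {1..n} G < mu p {1..n} H"
    using assms p p_less_1 by (intro mu_strict_mono) auto
  then show ?thesis using assms by simp
qed (use assms in auto)

lemma up_closed_case:
  assumes G: "G \<subseteq> Pow {1..n}" "up_closed {1..n} G" "shifted_above 0 G" "three_wise_intersecting t G"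
  shows "mu p {1..n} G \<le> p ^ t \<and> (mu p {1..n} G = p ^ t \<longrightarrow> extremal n t p G)"
proof (cases "\<forall>F\<in>G. {1..t} \<subseteq> F")
  case True
  define N where "N = near {1..n} {1..t} 0"
  have ext: "extremal n t p N"
    unfolding extremal_def N_def using t by (intro exI[of _ 0] exI[of _ "{1..t}"]) auto
  have "G \<subseteq> N" using True G(1) by (auto simp: N_def near_def)
  moreover have "N \<subseteq> Pow {1..n}" by (auto simp: N_def near_def)
  ultimately show ?thesis using mu_le_of_subset[of G N] mu_extremal[OF ext] ext t by auto
next
  case False
  then obtain F0 where F0: "F0 \<in> G" "\<not> {1..t} \<subseteq> F0" by auto
  show ?thesis
  proof (cases "G \<subseteq> near {1..n} {1..t + 3} 1")
    case True
    define N where "N = near {1..n} {1..t + 3} 1"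
    have F0n: "F0 \<subseteq> {1..n}" using F0 G(1) by auto
    have "t + 3 \<le> n"
      by (rule ground_set_large[OF G(2-4) F0(1) F0n F0(2)]) (use t in auto)
    then have eq: "mu p {1..n} N = p ^ t * (1 - (1 - p) * (1 + p - (real t + 2) * p\<^sup>2))"
      unfolding N_def by (intro mu_near_1_eq) auto
    have le: "(real t + 2) * p\<^sup>2 \<le> 1 + p" using p0_characterization(1)[of t p] t p by auto
    then have "0 \<le> (1 - p) * (1 + p - (real t + 2) * p\<^sup>2)" using p_less_1 by (intro mult_nonneg_nonneg) auto
    then have "p ^ t * (1 - (1 - p) * (1 + p - (real t + 2) * p\<^sup>2)) \<le> p ^ t * 1"
      using p by (intro mult_left_mono) auto
    then have N_le: "mu p {1..n} N \<le> p ^ t" using eq by simp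
    have GN: "G \<subseteq> N" "N \<subseteq> Pow {1..n}" using True by (auto simp: N_def near_def)
    have "extremal n t p G" if "mu p {1..n} G = p ^ t"
    proof -
      have "G = N" using mu_le_of_subset[OF GN N_le] that by simp
      then have "(1 - p) * (1 + p - (real t + 2) * p\<^sup>2) = 0" using that eq p by simp
      then have "p = p0 t" using p_less_1 p0_characterization(2)[of t p] t p by simp
      then show ?thesis
        unfolding extremal_def \<open>G = N\<close> N_def using \<open>t + 3 \<le> n\<close>
        by (intro exI[of _ 1] exI[of _ "{1..t + 3}"]) auto
    qed
    then show ?thesis using mu_le_of_subset[OF GN N_le] by simp
  next
    case False
    have "mu p {1..n} G < p ^ t"
      by (rule small_bias.mu_shifted_less[OF small_bias G t(2) F0 False])
    then show ?thesis by simp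
  qed
qed

text \<open>The generated up-closed family \<open>H\<close> is again shifted and three-wise \<open>t\<close>-intersecting. It has strictly larger
measure unless it equals \<open>G\<close>.\<close>

lemma shifted_case:
  assumes G: "G \<subseteq> Pow {1..n}" "shifted_above 0 G" "three_wise_intersecting t G"
  shows "mu p {1..n} G \<le> p ^ t \<and> (mu p {1..n} G = p ^ t \<longrightarrow> extremal n t p G)"
proof -
  define H where "H = {E. E \<subseteq> {1..n} \<and> (\<exists>F\<in>G. F \<subseteq> E)}"
  have GH: "G \<subseteq> H" "H \<subseteq> Pow {1..n}" using G(1) by (auto simp: H_def)
  have up: "up_closed {1..n} H" unfolding up_closed_def H_def by blast
  have shift: "shifted_above 0 H"
    unfolding shifted_above_def
  proof (intro ballI allI impI)
    fix E i j assume E: "E \<in> H" and ij: "0 < i \<and> i < j \<and> j \<in> E \<and> i \<notin> E"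
    then obtain F where F: "F \<in> G" "F \<subseteq> E" "E \<subseteq> {1..n}" by (auto simp: H_def)
    have "replace i j E \<subseteq> {1..n}" using F(3) ij by (auto simp: replace_def)
    moreover have "\<exists>F'\<in>G. F' \<subseteq> replace i j E"
    proof (cases "j \<in> F")
      case True
      then have "0 < i \<and> i < j \<and> j \<in> F \<and> i \<notin> F" using ij F(2) by blast
      then have "replace i j F \<in> G" using G(2) F(1) unfolding shifted_above_def by blast
      moreover have "replace i j F \<subseteq> replace i j E" using F(2) by (auto simp: replace_def)
      ultimately show ?thesis by blast
    next
      case False
      then have "F \<subseteq> replace i j E" using F(2) by (auto simp: replace_def)
      then show ?thesis using F(1) by blast
    qed
    ultimately show "replace i j E \<in> H" by (simp add: H_def)
  qed
  have three: "three_wise_intersecting t H"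
    unfolding three_wise_intersecting_def
  proof (intro ballI)
    fix A B C assume ABC: "A \<in> H" "B \<in> H" "C \<in> H"
    obtain A' B' C' where *: "A' \<in> G" "A' \<subseteq> A" "B' \<in> G" "B' \<subseteq> B" "C' \<in> G" "C' \<subseteq> C"
      using ABC unfolding H_def by blast
    have fin: "finite (A \<inter> B \<inter> C)" using ABC(1) finite_subset[of A "{1..n}"] by (simp add: H_def)
    have "t \<le> card (A' \<inter> B' \<inter> C')" using G(3) * unfolding three_wise_intersecting_def by simp
    also have "\<dots> \<le> card (A \<inter> B \<inter> C)" using * fin by (intro card_mono) auto
    finally show "t \<le> card (A \<inter> B \<inter> C)" .
  qed
  have H: "mu p {1..n} H \<le> p ^ t" "mu p {1..n} H = p ^ t \<longrightarrow> extremal n t p H"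
    using up_closed_case[OF GH(2) up shift three] by auto
  then show ?thesis using mu_le_of_subset[OF GH H(1)] by metis
qed

text \<open>A shift that changes the family lowers the sum of all its elements, so finitely many shifts lead to a shifted
family. They preserve the measure, and an extremal result can be pulled back through each of them.\<close>

lemma general_case:
  assumes "G \<subseteq> Pow {1..n}" "three_wise_intersecting t G"
  shows "mu p {1..n} G \<le> p ^ t \<and> (mu p {1..n} G = p ^ t \<longrightarrow> extremal n t p G)"
  using assms
proof (induction "\<Sum>F\<in>G. \<Sum>F" arbitrary: G rule: less_induct)
  case less
  show ?case
  proof (cases "shifted_above 0 G")
    case True
    then show ?thesis using shifted_case less.prems by simp
  next
    case False
    then obtain F i j where F: "F \<in> G" "j \<in> F" "i \<notin> F" "replace i j F \<notin> G" and ij: "0 < i" "i < j"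
      unfolding shifted_above_def by blast
    have "j \<in> {1..n}" using F(1,2) less.prems(1) by blast
    then have ij': "i \<in> {1..n}" "j \<in> {1..n}" "i \<noteq> j" using ij by auto
    have lt: "(\<Sum>F\<in>shift i j G. \<Sum>F) < (\<Sum>F\<in>G. \<Sum>F)"
      by (rule sum_shift_less[OF _ less.prems(1) ij(2) F]) simp
    have IH: "mu p {1..n} (shift i j G) \<le> p ^ t \<and>
        (mu p {1..n} (shift i j G) = p ^ t \<longrightarrow> extremal n t p (shift i j G))"
      by (rule less.hyps[OF lt shift_subset_Pow[OF less.prems(1) ij'(1)]
            three_wise_shift[OF less.prems(2) _ less.prems(1) ij'(3)]]) simp
    have eq: "mu p {1..n} (shift i j G) = mu p {1..n} G"
      by (rule mu_shift) (use less.prems in auto)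
    have "extremal n t p G" if "extremal n t p (shift i j G)"
    proof -
      from that obtain s U where s: "s = 0 \<or> s = 1 \<and> p = p0 t" and U: "U \<subseteq> {1..n}" "card U = t + 3 * s"
        and near: "shift i j G = near {1..n} U s" unfolding extremal_def by auto
      have "s < t" using s t by auto
      then obtain U' where "U' \<subseteq> {1..n}" "card U' = card U" "G = near {1..n} U' s"
        using shift_eq_near[OF _ less.prems U _ ij'(3,1,2) near] by auto
      then show ?thesis unfolding extremal_def using s U(2) by auto
    qed
    then show ?thesis using IH eq by simp
  qed
qed

end

lemma frankl_family_eq_near: "frankl_family n t s = near {1..n} {1..t + 3 * s} s"
proof -
  have "t + 2 * s \<le> card (F \<inter> {1..t + 3 * s}) \<longleftrightarrow> card ({1..t + 3 * s} - F) \<le> s" for F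
  proof -
    have "card (F \<inter> {1..t + 3 * s}) + card ({1..t + 3 * s} - F) = t + 3 * s"
      using card_Int_Diff[of "{1..t + 3 * s}" F] by (simp add: Int_commute)
    then show ?thesis by linarith
  qed
  then show ?thesis by (simp add: frankl_family_def near_def)
qed

lemma image_near:
  assumes "\<pi> permutes V" "finite U"
  shows "(\<lambda>F. \<pi> ` F) ` near V U s = near V (\<pi> ` U) s"
proof -
  have inj: "inj \<pi>" using assms(1) by (rule permutes_inj)
  have card: "card (\<pi> ` U - \<pi> ` F) = card (U - F)" for F
    using inj by (simp add: image_set_diff[symmetric] card_image inj_on_subset)
  have im: "\<pi> ` V = V" using assms(1) by (rule permutes_image)
  show ?thesis
  proof
    show "(\<lambda>F. \<pi> ` F) ` near V U s \<subseteq> near V (\<pi> ` U) s"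
      using im by (auto simp: near_def card)
    show "near V (\<pi> ` U) s \<subseteq> (\<lambda>F. \<pi> ` F) ` near V U s"
    proof
      fix E assume E: "E \<in> near V (\<pi> ` U) s"
      then have "E \<subseteq> \<pi> ` V" using im by (simp add: near_def)
      then obtain F where F: "F \<subseteq> V" "E = \<pi> ` F" by (auto simp: subset_image_iff)
      then show "E \<in> (\<lambda>F. \<pi> ` F) ` near V U s" using E by (auto simp: near_def card)
    qed
  qed
qed

lemma obtain_permutation:
  assumes "finite V" "U \<subseteq> V" "W \<subseteq> V" "card U = card W"
  obtains \<pi> where "\<pi> permutes V" "\<pi> ` U = W"
proof -
  have fin: "finite U" "finite W" using assms by (auto intro: finite_subset)
  obtain f where f: "bij_betw f U W" using finite_same_card_bij[OF fin assms(4)] by auto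
  have "card (V - U) = card (V - W)" using assms fin by (simp add: card_Diff_subset)
  then obtain g where g: "bij_betw g (V - U) (V - W)"
    using finite_same_card_bij[of "V - U" "V - W"] assms(1) by auto
  define \<pi> where "\<pi> x = (if x \<in> U then f x else if x \<in> V then g x else x)" for x
  have "bij_betw \<pi> U W \<longleftrightarrow> bij_betw f U W" by (rule bij_betw_cong) (simp add: \<pi>_def)
  with f have 1: "bij_betw \<pi> U W" by simp
  have "bij_betw \<pi> (V - U) (V - W) \<longleftrightarrow> bij_betw g (V - U) (V - W)"
    by (rule bij_betw_cong) (simp add: \<pi>_def)
  with g have 2: "bij_betw \<pi> (V - U) (V - W)" by simp
  have "bij_betw \<pi> (U \<union> (V - U)) (W \<union> (V - W))" by (rule bij_betw_combine[OF 1 2]) auto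
  then have "bij_betw \<pi> V V" using assms(2,3) by (simp add: Un_absorb1)
  then have "\<pi> permutes V" using assms(2) by (intro bij_imp_permutes) (auto simp: \<pi>_def)
  moreover have "\<pi> ` U = W" using 1 by (simp add: bij_betw_def)
  ultimately show thesis by (rule that)
qed

lemma isomorphic_frankl_family_iff:
  assumes "t + 3 * s \<le> n"
  shows "isomorphic_families n G (frankl_family n t s) \<longleftrightarrow>
    (\<exists>U\<subseteq>{1..n}. card U = t + 3 * s \<and> G = near {1..n} U s)"
proof
  assume "isomorphic_families n G (frankl_family n t s)"
  then obtain \<pi> where \<pi>: "\<pi> permutes {1..n}" "near {1..n} {1..t + 3 * s} s = (\<lambda>F. \<pi> ` F) ` G"
    by (auto simp: isomorphic_families_def frankl_family_eq_near)
  define \<rho> where "\<rho> = inv \<pi>"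
  have \<rho>: "\<rho> permutes {1..n}" unfolding \<rho>_def using \<pi>(1) by (rule permutes_inv)
  have "\<rho> ` \<pi> ` F = F" for F
    unfolding \<rho>_def using permutes_inj[OF \<pi>(1)] by (simp add: image_image)
  then have "G = (\<lambda>F. \<rho> ` F) ` (\<lambda>F. \<pi> ` F) ` G" by (simp add: image_image)
  also have "\<dots> = near {1..n} (\<rho> ` {1..t + 3 * s}) s"
    unfolding \<pi>(2)[symmetric] by (rule image_near[OF \<rho>]) simp
  finally have "G = near {1..n} (\<rho> ` {1..t + 3 * s}) s" .
  moreover have "\<rho> ` {1..t + 3 * s} \<subseteq> {1..n}"
    using assms image_mono[of "{1..t + 3 * s}" "{1..n}" \<rho>] permutes_image[OF \<rho>] by simp
  moreover have "card (\<rho> ` {1..t + 3 * s}) = t + 3 * s"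
    using permutes_inj[OF \<rho>] by (simp add: card_image inj_on_subset)
  ultimately show "\<exists>U\<subseteq>{1..n}. card U = t + 3 * s \<and> G = near {1..n} U s" by blast
next
  assume "\<exists>U\<subseteq>{1..n}. card U = t + 3 * s \<and> G = near {1..n} U s"
  then obtain U where U: "U \<subseteq> {1..n}" "card U = t + 3 * s" "G = near {1..n} U s" by auto
  obtain \<pi> where \<pi>: "\<pi> permutes {1..n}" "\<pi> ` U = {1..t + 3 * s}"
    using obtain_permutation[of "{1..n}" U "{1..t + 3 * s}"] U assms by auto
  have "frankl_family n t s = (\<lambda>F. \<pi> ` F) ` G"
    unfolding frankl_family_eq_near U(3) using image_near[OF \<pi>(1), of U s] \<pi>(2)
      finite_subset[OF U(1)] by simp
  then show "isomorphic_families n G (frankl_family n t s)"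
    unfolding isomorphic_families_def using \<pi>(1) by blast
qed

lemma extremal_iff:
  assumes "t \<le> n"
  shows "extremal n t p G \<longleftrightarrow> isomorphic_families n G (frankl_family n t 0) \<or>
    (t + 3 \<le> n \<and> p = p0 t \<and> isomorphic_families n G (frankl_family n t 1))"
proof -
  have split: "extremal n t p G \<longleftrightarrow> (\<exists>U\<subseteq>{1..n}. card U = t + 3 * 0 \<and> G = near {1..n} U 0) \<or>
      (p = p0 t \<and> (\<exists>U\<subseteq>{1..n}. card U = t + 3 * 1 \<and> G = near {1..n} U 1))"
    (is "_ \<longleftrightarrow> ?E 0 \<or> _ \<and> ?E 1")
  proof
    assume "extremal n t p G"
    then obtain s where "s = 0 \<or> s = 1 \<and> p = p0 t" "?E s" unfolding extremal_def by auto
    then show "?E 0 \<or> p = p0 t \<and> ?E 1" by auto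
  next
    assume "?E 0 \<or> p = p0 t \<and> ?E 1"
    then show "extremal n t p G"
    proof
      assume "?E 0"
      then obtain U where "U \<subseteq> {1..n}" "card U = t + 3 * 0" "G = near {1..n} U 0" by auto
      then show ?thesis unfolding extremal_def by (intro exI[of _ 0] exI[of _ U]) simp
    next
      assume "p = p0 t \<and> ?E 1"
      then obtain U where "p = p0 t" "U \<subseteq> {1..n}" "card U = t + 3 * 1" "G = near {1..n} U 1" by auto
      then show ?thesis unfolding extremal_def by (intro exI[of _ 1] exI[of _ U]) simp
    qed
  qed
  have iso0: "isomorphic_families n G (frankl_family n t 0) \<longleftrightarrow>
      (\<exists>U\<subseteq>{1..n}. card U = t + 3 * 0 \<and> G = near {1..n} U 0)"
    by (rule isomorphic_frankl_family_iff) (simp add: assms)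
  have iso1: "t + 3 \<le> n \<and> isomorphic_families n G (frankl_family n t 1) \<longleftrightarrow>
      (\<exists>U\<subseteq>{1..n}. card U = t + 3 * 1 \<and> G = near {1..n} U 1)"
  proof (cases "t + 3 \<le> n")
    case True
    then show ?thesis using isomorphic_frankl_family_iff[of t 1 n G] by simp
  next
    case False
    have "\<not> (\<exists>U\<subseteq>{1..n}. card U = t + 3 * 1 \<and> G = near {1..n} U 1)"
    proof
      assume "\<exists>U\<subseteq>{1..n}. card U = t + 3 * 1 \<and> G = near {1..n} U 1"
      then obtain U where U: "U \<subseteq> {1..n}" "card U = t + 3" by auto
      then show False using card_mono[OF _ U(1)] False by simp
    qed
    with False show ?thesis by simp
  qed
  show ?thesis unfolding split iso0[symmetric] iso1[symmetric] by blast
qed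

theorem theorem1:
  fixes n t :: nat and p :: real and \<G> :: "nat set set"
  assumes "15 \<le> t" and "t \<le> n"
    and "0 < p" and "p \<le> p0 t"
    and "\<G> \<subseteq> Pow {1..n}"
    and "three_wise_intersecting t \<G>"
  shows "biased_measure n p \<G> \<le> p ^ t \<and>
    (biased_measure n p \<G> = p ^ t \<longleftrightarrow>
       isomorphic_families n \<G> (frankl_family n t 0) \<or>
       (t + 3 \<le> n \<and> p = p0 t \<and> isomorphic_families n \<G> (frankl_family n t 1)))"
proof -
  have eq: "biased_measure n p \<G> = mu p {1..n} \<G>" by (simp add: biased_measure_def mu_def)
  have "mu p {1..n} \<G> \<le> p ^ t \<and> (mu p {1..n} \<G> = p ^ t \<longrightarrow> extremal n t p \<G>)"
    by (rule general_case[OF assms])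
  moreover have "extremal n t p \<G> \<Longrightarrow> mu p {1..n} \<G> = p ^ t"
    by (rule mu_extremal) (use assms(1) in simp_all)
  ultimately show ?thesis unfolding eq extremal_iff[OF assms(2), symmetric] by blast
qed

end
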